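(* There exist positive numbers $c$ and $\epsilon_0$ and unit vectors $\hat{v}^{(1)},\dots,\hat{v}^{(7)}\in\mathbb{R}^3$ with the following property. Let $\hat{\mathcal{U}}$ be any single-qubit unitary channel and let $\epsilon\in(0,\epsilon_0]$. Let $\hat{\mathcal{U}}_1,\dots,\hat{\mathcal{U}}_7$ be single-qubit unitary channels satisfying $$\tfrac12\big[\mathcal{J}(\hat{\mathcal{U}}_j\circ\hat{\mathcal{U}}^{-1})\big]_{MB}=\hat e^{(j)}\hat e^{(j)T},\qquad \hat e^{(j)}=\begin{pmatrix}\sqrt{1-(c\epsilon)^2}\\ c\epsilon\,\hat v^{(j)}\end{pmatrix}\in\mathbb{R}^4,$$ and let $\mathcal{U}_1,\dots,\mathcal{U}_7$ be any single-qubit unitary channels with $\tfrac12\|\hat{\mathcal{U}}_j-\mathcal{U}_j\|_\diamond\le\epsilon$ for all $j$. Then there exists a probability distribution $(p_j)_{j=1}^7$ such that the remnant error $\mathcal{E}_{\rm rem}=\big(\sum_j p_j\mathcal{U}_j\big)\circ\hat{\mathcal{U}}^{-1}$ is a Pauli channel, i.e. $\mathcal{E}_{\rm rem}(\rho)=\sum_{a\in\{I,X,Y,Z\}}\chi_{aa}P_a\rho P_a$ with $\chi_{aa}\ge0$. Moreover, for the probability distribution $p$ that minimizes $\tfrac12\|\hat{\mathcal{U}}-\sum_j p_j\mathcal{U}_j\|_\diamond$ among all probability distributions on $\{1,\dots,7\}$ for which $\mathcal{E}_{\rm rem}$ is a Pauli channel, $$((c-1)\epsilon)^2\le \tfrac12\Big\|\hat{\mathcal{U}}-\sum_{j=1}^7p_j\mathcal{U}_j\Big\|_\diamond\le((c+1)\epsilon)^2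 .$$
   Context: A single-qubit unitary channel is $\mathcal{U}(\rho)=U\rho U^\dagger$ with $U\in U(2)$. $\|\cdot\|_\diamond$ is the diamond norm. For a linear map $\Phi$ on $2\times2$ matrices, the Choi operator is $\mathcal{J}(\Phi)=(\mathrm{Id}\otimes\Phi)(|\Omega\rangle\langle\Omega|)$ with the unnormalized $|\Omega\rangle=|00\rangle+|11\rangle$. The magic basis is $|\Psi_1\rangle=\frac{1}{\sqrt2}(|00\rangle+|11\rangle)$, $|\Psi_2\rangle=\frac{i}{\sqrt2}(|00\rangle-|11\rangle)$, $|\Psi_3\rangle=\frac{i}{\sqrt2}(|01\rangle+|10\rangle)$, $|\Psi_4\rangle=\frac{1}{\sqrt2}(|01\rangle-|10\rangle)$, and $[A]_{MB}$ denotes the $4\times4$ matrix with entries $([A]_{MB})_{ij}=\langle\Psi_i|A|\Psi_j\rangle$. For every single-qubit unitary channel $\mathcal{U}$ one has $\tfrac12[\mathcal{J}(\mathcal{U})]_{MB}=rr^T$ for a real unit vector $r\in\mathbb{R}^4$. $P_I=I,P_X=X,P_Y=Y,P_Z=Z$ are the Pauli matrices. *)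

theory Defs
  imports "HOL-Analysis.Analysis"
begin

text \<open>Matrices on a finite index type as functions of row and column index.
  A qubit has index type bool (False = |0>, True = |1>); two qubits have
  index type bool \<times> bool, where (a,b) = |a>|b> (first factor = reference system).\<close>

type_synonym 'n cmat = "'n \<Rightarrow> 'n \<Rightarrow> complex"

definition mmult :: "('n::finite) cmat \<Rightarrow> 'n cmat \<Rightarrow> 'n cmat" where
  "mmult A B = (\<lambda>i k. \<Sum>j\<in>UNIV. A i j * B j k)"

definition adj :: "'n cmat \<Rightarrow> 'n cmat" where
  "adj A = (\<lambda>i j. cnj (A j i))"

definition idm :: "'n cmat" where
  "idm = (\<lambda>i j. if i = j then 1 else 0)"

definition mtrace :: "('n::finite) cmat \<Rightarrow> complex" where
  "mtrace A = (\<Sum>i\<in>UNIV. A i i)"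

definition unitary_mat :: "('n::finite) cmat \<Rightarrow> bool" where
  "unitary_mat U \<longleftrightarrow> mmult (adj U) U = idm"

text \<open>Trace norm, via its variational characterisation
  \<open>\<parallel>A\<parallel>\<^sub>1 = max over unitaries W of Re tr(W A)\<close>.\<close>
definition trace_norm :: "('n::finite) cmat \<Rightarrow> real" where
  "trace_norm A = Sup {Re (mtrace (mmult W A)) | W. unitary_mat W}"

type_synonym qmap = "bool cmat \<Rightarrow> bool cmat"

text \<open>(Id \<otimes> \<Phi>) acting blockwise on a two-qubit operator (for linear \<Phi>).\<close>
definition id_tensor :: "qmap \<Rightarrow> (bool \<times> bool) cmat \<Rightarrow> (bool \<times> bool) cmat" where
  "id_tensor \<Phi> X = (\<lambda>(a,b) (a',b'). \<Phi> (\<lambda>x y. X (a,x) (a',y)) b b')"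

definition diamond_norm :: "qmap \<Rightarrow> real" where
  "diamond_norm \<Phi> = Sup {trace_norm (id_tensor \<Phi> X) | X. trace_norm X \<le> 1}"

definition uchan :: "bool cmat \<Rightarrow> qmap" where
  "uchan U = (\<lambda>\<rho>. mmult (mmult U \<rho>) (adj U))"

definition unitary_channel :: "qmap \<Rightarrow> bool" where
  "unitary_channel \<Phi> \<longleftrightarrow> (\<exists>U. unitary_mat U \<and> \<Phi> = uchan U)"

text \<open>Choi operator with the unnormalised |\<Omega>> = |00> + |11>.\<close>
definition Omega :: "(bool \<times> bool) cmat" where
  "Omega = (\<lambda>(a,b) (a',b'). if a = b \<and> a' = b' then 1 else 0)"

definition choi :: "qmap \<Rightarrow> (bool \<times> bool) cmat" where
  "choi \<Phi> = id_tensor \<Phi> Omega"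

definition magic :: "nat \<Rightarrow> (bool \<times> bool) \<Rightarrow> complex" where
  "magic k = (\<lambda>(a,b).
     (if k = 1 then (if a = b then 1 else 0)
      else if k = 2 then (if a = b then (if a then - \<i> else \<i>) else 0)
      else if k = 3 then (if a \<noteq> b then \<i> else 0)
      else if k = 4 then (if a \<noteq> b then (if a then -1 else 1) else 0)
      else 0) / complex_of_real (sqrt 2))"

definition in_MB :: "(bool \<times> bool) cmat \<Rightarrow> nat \<Rightarrow> nat \<Rightarrow> complex" where
  "in_MB A i j = (\<Sum>x\<in>UNIV. \<Sum>y\<in>UNIV. cnj (magic i x) * A x y * magic j y)"

definition pauli :: "nat \<Rightarrow> bool cmat" where
  "pauli a = (\<lambda>r s.
     if a = 0 then (if r = s then 1 else 0)
     else if a = 1 then (if r \<noteq> s then 1 else 0)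
     else if a = 2 then (if r = s then 0 else if r then \<i> else - \<i>)
     else if a = 3 then (if r = s then (if r then -1 else 1) else 0)
     else 0)"

definition pauli_channel :: "qmap \<Rightarrow> bool" where
  "pauli_channel E \<longleftrightarrow> (\<exists>(chi::nat \<Rightarrow> real). (\<forall>a\<in>{0..3}. chi a \<ge> 0) \<and>
      (\<forall>\<rho>. E \<rho> = (\<lambda>r s. \<Sum>a\<in>{0..3}. complex_of_real (chi a) *
                    mmult (mmult (pauli a) \<rho>) (pauli a) r s)))"

definition mixture :: "(nat \<Rightarrow> real) \<Rightarrow> (nat \<Rightarrow> qmap) \<Rightarrow> qmap" where
  "mixture p \<Phi> = (\<lambda>\<rho> r s. \<Sum>j\<in>{1..7}. complex_of_real (p j) * \<Phi> j \<rho> r s)"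

definition qdiff :: "qmap \<Rightarrow> qmap \<Rightarrow> qmap" where
  "qdiff \<Phi> \<Psi> = (\<lambda>\<rho> r s. \<Phi> \<rho> r s - \<Psi> \<rho> r s)"

definition prob_dist7 :: "(nat \<Rightarrow> real) \<Rightarrow> bool" where
  "prob_dist7 p \<longleftrightarrow> (\<forall>j\<in>{1..7}. p j \<ge> 0) \<and> (\<Sum>j\<in>{1..7}. p j) = 1"

definition ehat :: "real \<Rightarrow> real \<Rightarrow> real^3 \<Rightarrow> nat \<Rightarrow> real" where
  "ehat c \<epsilon> v k = (if k = 1 then sqrt (1 - (c * \<epsilon>)\<^sup>2)
                   else if k = 2 then c * \<epsilon> * v $ 1
                   else if k = 3 then c * \<epsilon> * v $ 2
                   else if k = 4 then c * \<epsilon> * v $ 3 else 0)"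

end

theory Submission
  imports Defs
begin

text \<open>In the magic basis a unitary \<open>V\<close> becomes, up to a phase, a real unit vector \<open>r \<in> \<real>\<^sup>4\<close>, and a
  mixture of unitaries is a Pauli channel iff the six off-diagonal entries of \<open>\<Sum>\<^sub>j p\<^sub>j r\<^sub>j r\<^sub>j\<^sup>T\<close> vanish.
  After dividing the vector parts by \<open>c\<epsilon>\<close>, the off-diagonal entries of \<open>r\<^sub>j r\<^sub>j\<^sup>T\<close> are \<open>O(1/c)\<close>-close to
  \<open>(v\<^sub>1, v\<^sub>2, v\<^sub>3, v\<^sub>1v\<^sub>2, v\<^sub>1v\<^sub>3, v\<^sub>2v\<^sub>3)\<close> at \<open>v = v\<^sup>(\<^sup>j\<^sup>)\<close>.  The seven directions are chosen so that the
  origin of \<open>\<real>\<^sup>6\<close> is interior to the simplex spanned by these points; this persists under small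
  perturbations, so weights exist once \<open>c\<close> is large.  For such weights the diamond distance to the
  target equals \<open>2 \<Sum>\<^sub>j p\<^sub>j (1 - r\<^sub>j\<^sub>1\<^sup>2)\<close>, and \<open>1 - r\<^sub>j\<^sub>1\<^sup>2\<close> is the squared sine of an angle that differs from
  \<open>arcsin (c\<epsilon>)\<close> by at most \<open>arcsin \<epsilon>\<close>.\<close>

section \<open>Trace norm\<close>

lemma mmult_assoc: "mmult (mmult A B) C = mmult A (mmult B C)"
proof (intro ext)
  fix i k
  have "mmult (mmult A B) C i k = (\<Sum>j\<in>UNIV. \<Sum>l\<in>UNIV. A i l * B l j * C j k)"
    by (simp add: mmult_def sum_distrib_right)
  also have "\<dots> = (\<Sum>l\<in>UNIV. \<Sum>j\<in>UNIV. A i l * B l j * C j k)"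
    by (rule sum.swap)
  also have "\<dots> = mmult A (mmult B C) i k"
    by (simp add: mmult_def sum_distrib_left mult.assoc)
  finally show "mmult (mmult A B) C i k = mmult A (mmult B C) i k" .
qed

lemma mmult_idm [simp]: "mmult idm A = A" "mmult A idm = A"
  by (auto simp: mmult_def idm_def fun_eq_iff if_distrib if_distribR cong: if_cong)

lemma adj_mmult: "adj (mmult A B) = mmult (adj B) (adj A)"
  by (simp add: adj_def mmult_def fun_eq_iff mult.commute)

lemma adj_adj [simp]: "adj (adj A) = A"
  by (simp add: adj_def)

lemma adj_idm [simp]: "adj idm = idm"
  by (auto simp: adj_def idm_def fun_eq_iff)

lemma mtrace_mmult_commute: "mtrace (mmult A B) = mtrace (mmult B A)"
  unfolding mtrace_def mmult_def by (subst sum.swap) (simp add: mult.commute)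

lemma unitary_matD: "unitary_mat U \<Longrightarrow> mmult (adj U) U = idm"
  by (simp add: unitary_mat_def)

text \<open>\<open>unitary_mat\<close> asserts only a left inverse. Transporting to
  \<open>complex^'a^'a\<close> brings in the fact that a one-sided inverse of a square matrix is
  two-sided.\<close>

lemma unitary_mat_adj_right:
  assumes "unitary_mat U"
  shows "mmult U (adj U) = idm"
proof -
  define M where "M = (\<lambda>A :: 'a cmat. (\<chi> i j. A i j) :: complex^'a^'a)"
  have M_mult: "M A ** M B = M (mmult A B)" for A B
    by (simp add: M_def matrix_matrix_mult_def mmult_def vec_eq_iff)
  have M_inj: "A = B" if "M A = M B" for A B
    using that by (auto simp: M_def vec_eq_iff fun_eq_iff)
  have M_id: "M idm = mat 1"
    by (simp add: M_def mat_def idm_def vec_eq_iff)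
  have "M (adj U) ** M U = mat 1"
    using assms by (simp add: M_mult M_id unitary_mat_def)
  hence "M U ** M (adj U) = mat 1"
    using matrix_left_right_inverse by blast
  thus ?thesis
    by (intro M_inj) (simp add: M_mult M_id)
qed

lemma unitary_mat_adj: "unitary_mat U \<Longrightarrow> unitary_mat (adj U)"
  by (simp add: unitary_mat_def unitary_mat_adj_right)

lemma unitary_mat_idm: "unitary_mat idm"
  by (simp add: unitary_mat_def)

lemma unitary_mat_mmult:
  assumes "unitary_mat A" "unitary_mat B"
  shows "unitary_mat (mmult A B)"
proof -
  have "mmult (adj (mmult A B)) (mmult A B) = mmult (adj B) (mmult (mmult (adj A) A) B)"
    by (simp add: adj_mmult mmult_assoc)
  thus ?thesis
    using assms by (simp add: unitary_mat_def)
qed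

lemma unitary_mat_uminus: "unitary_mat U \<Longrightarrow> unitary_mat (\<lambda>i j. - U i j)"
  by (simp add: unitary_mat_def mmult_def adj_def)

section \<open>Inner product and pure states\<close>

definition cip :: "('n::finite \<Rightarrow> complex) \<Rightarrow> ('n \<Rightarrow> complex) \<Rightarrow> complex" where
  "cip \<psi> \<phi> = (\<Sum>i\<in>UNIV. cnj (\<psi> i) * \<phi> i)"

definition pure_state :: "('n \<Rightarrow> complex) \<Rightarrow> 'n cmat" where
  "pure_state \<psi> = (\<lambda>i j. \<psi> i * cnj (\<psi> j))"

lemma cnj_cip: "cnj (cip \<psi> \<phi>) = cip \<phi> \<psi>"
  by (simp add: cip_def mult.commute)

lemma cip_diff_right: "cip \<psi> (\<lambda>i. f i - g i) = cip \<psi> f - cip \<psi> g"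
  by (simp add: cip_def algebra_simps sum_subtractf)

lemma cip_scale_right: "cip \<psi> (\<lambda>i. c * f i) = c * cip \<psi> f"
  by (simp add: cip_def sum_distrib_left mult_ac)

lemma cip_diff_left: "cip (\<lambda>i. f i - g i) \<psi> = cip f \<psi> - cip g \<psi>"
  by (simp add: cip_def algebra_simps sum_subtractf)

lemma cip_scale_left: "cip (\<lambda>i. c * f i) \<psi> = cnj c * cip f \<psi>"
  by (simp add: cip_def sum_distrib_left mult_ac)

lemma cip_self: "cip \<psi> \<psi> = of_real (\<Sum>i\<in>UNIV. (cmod (\<psi> i))\<^sup>2)"
  unfolding cip_def by (simp only: of_real_sum complex_norm_square mult.commute)

lemma cip_mult_cnj: "cip \<psi> \<phi> * cip \<phi> \<psi> = of_real ((cmod (cip \<psi> \<phi>))\<^sup>2)"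
  by (metis cnj_cip complex_norm_square of_real_power)

lemma mtrace_pure: "mtrace (pure_state \<psi>) = cip \<psi> \<psi>"
  by (simp add: mtrace_def pure_state_def cip_def mult.commute)

lemma cip_unitary:
  assumes "unitary_mat W"
  shows "cip (\<lambda>i. \<Sum>j\<in>UNIV. W i j * \<psi> j) (\<lambda>i. \<Sum>j\<in>UNIV. W i j * \<phi> j) = cip \<psi> \<phi>"
proof -
  have "cip (\<lambda>i. \<Sum>j\<in>UNIV. W i j * \<psi> j) (\<lambda>i. \<Sum>j\<in>UNIV. W i j * \<phi> j)
      = (\<Sum>i\<in>UNIV. \<Sum>k\<in>UNIV. \<Sum>j\<in>UNIV. cnj (\<psi> k) * (adj W k i * W i j) * \<phi> j)"
    unfolding cip_def cnj_sum complex_cnj_mult sum_product adj_def by (simp add: mult_ac)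
  also have "\<dots> = (\<Sum>k\<in>UNIV. \<Sum>i\<in>UNIV. \<Sum>j\<in>UNIV. cnj (\<psi> k) * (adj W k i * W i j) * \<phi> j)"
    by (rule sum.swap)
  also have "\<dots> = (\<Sum>k\<in>UNIV. \<Sum>j\<in>UNIV. \<Sum>i\<in>UNIV. cnj (\<psi> k) * (adj W k i * W i j) * \<phi> j)"
    by (intro sum.cong refl sum.swap)
  also have "\<dots> = (\<Sum>k\<in>UNIV. \<Sum>j\<in>UNIV. cnj (\<psi> k) * mmult (adj W) W k j * \<phi> j)"
    by (simp add: mmult_def sum_distrib_left sum_distrib_right)
  also have "\<dots> = cip \<psi> \<phi>"
    using assms
    by (simp add: unitary_mat_def idm_def cip_def if_distrib if_distribR cong: if_cong)
  finally show ?thesis .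
qed

lemma unitary_entry_le_1:
  assumes "unitary_mat W"
  shows "cmod (W i j) \<le> 1"
proof -
  have "(\<Sum>k\<in>UNIV. cnj (W k j) * W k j) = 1"
    using fun_cong[OF fun_cong[OF unitary_matD[OF assms], of j], of j]
    by (simp add: mmult_def adj_def idm_def)
  hence "complex_of_real (\<Sum>k\<in>UNIV. (cmod (W k j))\<^sup>2) = 1"
    using cip_self[of "\<lambda>k. W k j"] by (simp add: cip_def)
  hence "(\<Sum>k\<in>UNIV. (cmod (W k j))\<^sup>2) = 1"
    using of_real_eq_1_iff by blast
  moreover have "(cmod (W i j))\<^sup>2 \<le> (\<Sum>k\<in>UNIV. (cmod (W k j))\<^sup>2)"
    by (rule member_le_sum) auto
  ultimately show ?thesis
    by (simp add: abs_square_le_1)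
qed

section \<open>Bounds on the trace norm\<close>

text \<open>A real \<open>Sup\<close> is informative only for a bounded set. Entries of a unitary
  have modulus at most 1, so the sum of the moduli of the entries of \<open>A\<close> dominates
  every witness value.\<close>

lemma bdd_above_trace_norm:
  fixes A :: "'n::finite cmat"
  shows "bdd_above {Re (mtrace (mmult W A)) | W. unitary_mat W}"
proof (rule bdd_aboveI)
  fix t assume "t \<in> {Re (mtrace (mmult W A)) | W. unitary_mat W}"
  then obtain W where W: "unitary_mat W" "t = Re (mtrace (mmult W A))"
    by blast
  have "t \<le> cmod (mtrace (mmult W A))"
    using W complex_Re_le_cmod by blast
  also have "\<dots> \<le> (\<Sum>i\<in>UNIV. \<Sum>j\<in>UNIV. cmod (W i j * A j i))"
    unfolding mtrace_def mmult_def by (intro order.trans[OF norm_sum] sum_mono order.refl)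
  also have "\<dots> \<le> (\<Sum>i\<in>UNIV. \<Sum>j\<in>UNIV. cmod (A j i))"
    by (intro sum_mono) (simp add: norm_mult mult_left_le_one_le unitary_entry_le_1 W)
  finally show "t \<le> (\<Sum>i\<in>UNIV. \<Sum>j\<in>UNIV. cmod (A j i))" .
qed

lemma trace_norm_upper:
  "unitary_mat W \<Longrightarrow> Re (mtrace (mmult W A)) \<le> trace_norm A"
  unfolding trace_norm_def by (intro cSup_upper bdd_above_trace_norm) auto

lemma trace_norm_leI:
  assumes "\<And>W. unitary_mat W \<Longrightarrow> Re (mtrace (mmult W A)) \<le> b"
  shows "trace_norm A \<le> b"
  unfolding trace_norm_def
  using assms unitary_mat_idm by (intro cSup_least) auto

lemma trace_norm_upper_abs:
  assumes "unitary_mat W"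
  shows "\<bar>Re (mtrace (mmult W A))\<bar> \<le> trace_norm A"
proof -
  have "mtrace (mmult (\<lambda>i j. - W i j) A) = - mtrace (mmult W A)"
    by (simp add: mtrace_def mmult_def sum_negf)
  with trace_norm_upper[OF unitary_mat_uminus[OF assms], of A] trace_norm_upper[OF assms, of A]
  show ?thesis by simp
qed

text \<open>For one fixed witness \<open>W\<close> the trace is linear, so each term can be
  estimated on its own. Absolute values appear because coefficients may be negative, as they are for
  differences of channels.\<close>

lemma trace_norm_sum_le:
  assumes "finite K"
  shows "trace_norm (\<lambda>i j. \<Sum>k\<in>K. complex_of_real (c k) * A k i j) \<le> (\<Sum>k\<in>K. \<bar>c k\<bar> * trace_norm (A k))"
proof (rule trace_norm_leI)
  fix W :: "'b cmat" assume W: "unitary_mat W"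
  have "mtrace (mmult W (\<lambda>i j. \<Sum>k\<in>K. complex_of_real (c k) * A k i j))
      = (\<Sum>i\<in>UNIV. \<Sum>j\<in>UNIV. \<Sum>k\<in>K. complex_of_real (c k) * (W i j * A k j i))"
    by (simp add: mtrace_def mmult_def sum_distrib_left mult_ac)
  also have "\<dots> = (\<Sum>i\<in>UNIV. \<Sum>k\<in>K. \<Sum>j\<in>UNIV. complex_of_real (c k) * (W i j * A k j i))"
    by (intro sum.cong refl sum.swap)
  also have "\<dots> = (\<Sum>k\<in>K. \<Sum>i\<in>UNIV. \<Sum>j\<in>UNIV. complex_of_real (c k) * (W i j * A k j i))"
    by (rule sum.swap)
  also have "\<dots> = (\<Sum>k\<in>K. complex_of_real (c k) * mtrace (mmult W (A k)))"
    by (simp add: mtrace_def mmult_def sum_distrib_left)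
  finally have "Re (mtrace (mmult W (\<lambda>i j. \<Sum>k\<in>K. complex_of_real (c k) * A k i j)))
      = (\<Sum>k\<in>K. c k * Re (mtrace (mmult W (A k))))"
    by simp
  also have "\<dots> \<le> (\<Sum>k\<in>K. \<bar>c k\<bar> * trace_norm (A k))"
  proof (rule sum_mono)
    fix k
    have "c k * Re (mtrace (mmult W (A k))) \<le> \<bar>c k\<bar> * \<bar>Re (mtrace (mmult W (A k)))\<bar>"
      by (metis abs_ge_self abs_mult)
    also have "\<dots> \<le> \<bar>c k\<bar> * trace_norm (A k)"
      by (intro mult_left_mono trace_norm_upper_abs W) simp
    finally show "c k * Re (mtrace (mmult W (A k))) \<le> \<bar>c k\<bar> * trace_norm (A k)" .
  qed
  finally show "Re (mtrace (mmult W (\<lambda>i j. \<Sum>k\<in>K. complex_of_real (c k) * A k i j)))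
      \<le> (\<Sum>k\<in>K. \<bar>c k\<bar> * trace_norm (A k))" .
qed

text \<open>Cyclicity of the trace moves \<open>L\<close> and \<open>adj L\<close> onto the witness,
  which stays unitary.\<close>

lemma trace_norm_unitary_conj:
  assumes "unitary_mat L"
  shows "trace_norm (mmult (mmult L A) (adj L)) \<le> trace_norm A"
proof (rule trace_norm_leI)
  fix W :: "'a cmat" assume W: "unitary_mat W"
  have "mtrace (mmult W (mmult (mmult L A) (adj L))) = mtrace (mmult (mmult W (mmult L A)) (adj L))"
    by (simp add: mmult_assoc)
  also have "\<dots> = mtrace (mmult (adj L) (mmult W (mmult L A)))"
    by (rule mtrace_mmult_commute)
  also have "\<dots> = mtrace (mmult (mmult (adj L) (mmult W L)) A)"
    by (simp add: mmult_assoc)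
  finally show "Re (mtrace (mmult W (mmult (mmult L A) (adj L)))) \<le> trace_norm A"
    using assms W by (simp add: trace_norm_upper unitary_mat_mmult unitary_mat_adj)
qed

text \<open>With \<open>\<phi>\<close> the image of \<open>\<psi>\<close> under the witness, the
  trace is the overlap of two unit vectors. Expanding the nonnegative squared length of
  \<open>\<phi> - \<psi>\<close> bounds its real part by 1.\<close>

lemma trace_norm_pure_le:
  assumes "cip \<psi> \<psi> = 1"
  shows "trace_norm (pure_state \<psi>) \<le> 1"
proof (rule trace_norm_leI)
  fix W :: "'a cmat" assume W: "unitary_mat W"
  define \<phi> where "\<phi> = (\<lambda>i. \<Sum>j\<in>UNIV. W i j * \<psi> j)"
  have "mtrace (mmult W (pure_state \<psi>)) = cip \<psi> \<phi>"
    by (simp add: mtrace_def mmult_def pure_state_def cip_def \<phi>_def sum_distrib_left mult_ac)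
  moreover have "cip \<phi> \<phi> = 1"
    using assms cip_unitary[OF W] by (simp add: \<phi>_def)
  moreover have "cip (\<lambda>i. \<phi> i - \<psi> i) (\<lambda>i. \<phi> i - \<psi> i) = cip \<phi> \<phi> + cip \<psi> \<psi> - (cip \<psi> \<phi> + cnj (cip \<psi> \<phi>))"
    by (simp add: cip_diff_left cip_diff_right cnj_cip)
  moreover have "0 \<le> Re (cip (\<lambda>i. \<phi> i - \<psi> i) (\<lambda>i. \<phi> i - \<psi> i))"
    by (simp add: cip_self sum_nonneg)
  ultimately show "Re (mtrace (mmult W (pure_state \<psi>))) \<le> 1"
    using assms by simp
qed

text \<open>The witness is the reflection \<open>1 - 2\<xi>\<xi>\<^sup>*\<close>.\<close>
lemma trace_norm_ge_reflection:
  assumes "cip \<xi> \<xi> = 1"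
  shows "\<bar>Re (mtrace A) - 2 * Re (cip \<xi> (\<lambda>i. \<Sum>j\<in>UNIV. A i j * \<xi> j))\<bar> \<le> trace_norm A"
proof -
  define P where "P = pure_state \<xi>"
  define W where "W = (\<lambda>i j. idm i j - 2 * P i j)"
  have adjW: "adj W = W"
    by (auto simp: W_def P_def adj_def idm_def pure_state_def fun_eq_iff)
  have PP: "mmult P P = P"
  proof -
    have "mmult P P i j = P i j * cip \<xi> \<xi>" for i j
      by (simp add: mmult_def P_def pure_state_def cip_def sum_distrib_left mult_ac)
    with assms show ?thesis by (simp add: fun_eq_iff)
  qed
  have W_left: "mmult W B i j = B i j - 2 * mmult P B i j" for B i j
  proof -
    have "mmult W B i j = mmult idm B i j - 2 * mmult P B i j"
      unfolding mmult_def W_def by (simp add: left_diff_distrib sum_subtractf sum_distrib_left mult.assoc)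
    thus ?thesis by simp
  qed
  have W_right: "mmult P W i j = P i j - 2 * mmult P P i j" for i j
  proof -
    have "mmult P W i j = mmult P idm i j - 2 * mmult P P i j"
      unfolding mmult_def W_def by (simp add: right_diff_distrib sum_subtractf sum_distrib_left mult_ac)
    thus ?thesis by simp
  qed
  have "mmult W W i j = idm i j" for i j
    by (simp add: W_left W_right PP) (simp add: W_def)
  hence "unitary_mat W"
    by (simp add: unitary_mat_def adjW fun_eq_iff)
  moreover have "mtrace (mmult W A) = mtrace A - 2 * cip \<xi> (\<lambda>i. \<Sum>j\<in>UNIV. A i j * \<xi> j)"
  proof -
    have "mtrace (mmult P A) = mtrace (mmult A P)"
      by (rule mtrace_mmult_commute)
    also have "\<dots> = cip \<xi> (\<lambda>i. \<Sum>j\<in>UNIV. A i j * \<xi> j)"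
      by (simp add: mtrace_def mmult_def P_def pure_state_def cip_def sum_distrib_left mult_ac)
    finally show ?thesis
      by (simp add: mtrace_def W_left sum_subtractf flip: sum_distrib_left)
  qed
  ultimately show ?thesis
    using trace_norm_upper_abs[of W A] by simp
qed

lemma cip_pure_state:
  "cip \<xi> (\<lambda>i. \<Sum>j\<in>UNIV. pure_state \<psi> i j * \<xi> j) = of_real ((cmod (cip \<psi> \<xi>))\<^sup>2)"
proof -
  have "(\<Sum>j\<in>UNIV. pure_state \<psi> i j * \<xi> j) = cip \<psi> \<xi> * \<psi> i" for i
    by (simp add: pure_state_def cip_def sum_distrib_left mult_ac)
  hence "cip \<xi> (\<lambda>i. \<Sum>j\<in>UNIV. pure_state \<psi> i j * \<xi> j) = cip \<psi> \<xi> * cip \<xi> \<psi>"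
    by (simp add: cip_scale_right)
  thus ?thesis
    by (simp only: cip_mult_cnj)
qed

text \<open>The difference of two distinct pure states has trace zero and nonzero eigenvalues
  \<open>s\<close> and \<open>-s\<close>. The reflection in a unit eigenvector for \<open>-s\<close>
  is a witness with value \<open>2 * s\<close>.\<close>

lemma trace_norm_pure_diff_ge:
  assumes \<psi>: "cip \<psi> \<psi> = 1" and \<phi>: "cip \<phi> \<phi> = 1"
    and s: "0 < s" "s\<^sup>2 = 1 - (cmod (cip \<psi> \<phi>))\<^sup>2"
  shows "2 * s \<le> trace_norm (\<lambda>i j. pure_state \<psi> i j - pure_state \<phi> i j)"
proof -
  define z where "z = cip \<psi> \<phi>"
  \<comment> \<open>\<open>N\<close> is the length of the eigenvector \<open>\<eta>\<close>
    introduced below; \<open>0 < s\<close> keeps it nonzero.\<close>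
  define N where "N = sqrt (2 * s\<^sup>2 * (1 + s))"
  \<comment> \<open>\<open>z\<psi> - (1 + s)\<phi>\<close> is an eigenvector of the difference for its eigenvalue \<open>-s\<close>.\<close>
  define \<eta> where "\<eta> = (\<lambda>i. z * \<psi> i - complex_of_real (1 + s) * \<phi> i)"
  define \<xi> where "\<xi> = (\<lambda>i. complex_of_real (1 / N) * \<eta> i)"
  have N: "0 < N" "N\<^sup>2 = 2 * s\<^sup>2 * (1 + s)"
    using s(1) by (auto simp: N_def)
  have zz: "z * cnj z = complex_of_real (1 - s\<^sup>2)"
    using cip_mult_cnj[of \<psi> \<phi>] s by (simp add: z_def cnj_cip)
  hence zz': "cnj z * z = complex_of_real (1 - s\<^sup>2)"
    by (simp add: mult.commute)
  have \<phi>\<psi>: "cip \<phi> \<psi> = cnj z"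
    by (simp add: z_def cnj_cip)
  have \<psi>\<eta>: "cip \<psi> \<eta> = - complex_of_real s * z"
    unfolding \<eta>_def by (simp only: cip_diff_right cip_scale_right \<psi> z_def[symmetric]) (simp add: algebra_simps)
  have \<phi>\<eta>: "cip \<phi> \<eta> = - complex_of_real (s * (1 + s))"
    unfolding \<eta>_def by (simp only: cip_diff_right cip_scale_right \<phi> \<phi>\<psi> zz)
      (simp add: algebra_simps power2_eq_square)
  have \<eta>\<eta>: "cip \<eta> \<eta> = complex_of_real (N\<^sup>2)"
  proof -
    have "cip \<eta> \<eta> = cnj z * cip \<psi> \<eta> - complex_of_real (1 + s) * cip \<phi> \<eta>"
      by (subst \<eta>_def, simp only: cip_diff_left cip_scale_left) simp
    also have "\<dots> = - complex_of_real s * (cnj z * z) + complex_of_real (1 + s) * complex_of_real (s * (1 + s))"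
      unfolding \<psi>\<eta> \<phi>\<eta> by (simp add: algebra_simps)
    also have "\<dots> = complex_of_real (N\<^sup>2)"
      unfolding zz' N by (simp add: algebra_simps power2_eq_square)
    finally show ?thesis .
  qed
  have "cip \<xi> \<xi> = complex_of_real (1 / N * (1 / N)) * cip \<eta> \<eta>"
    unfolding \<xi>_def cip_scale_left cip_scale_right by simp
  also have "\<dots> = complex_of_real (1 / N * (1 / N) * N\<^sup>2)"
    by (simp only: \<eta>\<eta> of_real_mult)
  also have "1 / N * (1 / N) * N\<^sup>2 = 1"
    using N(1) by (simp add: power2_eq_square)
  finally have \<xi>: "cip \<xi> \<xi> = 1" by simp
  have "(cmod (cip \<psi> \<xi>))\<^sup>2 = s\<^sup>2 * (1 - s\<^sup>2) / N\<^sup>2"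
    using s N(1) unfolding \<xi>_def cip_scale_right \<psi>\<eta>
    by (simp add: norm_mult norm_divide power_divide power_mult_distrib z_def)
  moreover have "(cmod (cip \<phi> \<xi>))\<^sup>2 = s\<^sup>2 * (1 + s)\<^sup>2 / N\<^sup>2"
    using s N(1) unfolding \<xi>_def cip_scale_right \<phi>\<eta>
    by (simp add: norm_mult norm_divide power_divide power_mult_distrib del: of_real_add)
  ultimately have "(cmod (cip \<psi> \<xi>))\<^sup>2 - (cmod (cip \<phi> \<xi>))\<^sup>2 = (s\<^sup>2 * (1 - s\<^sup>2) - s\<^sup>2 * (1 + s)\<^sup>2) / N\<^sup>2"
    by (simp add: diff_divide_distrib)
  also have "s\<^sup>2 * (1 - s\<^sup>2) - s\<^sup>2 * (1 + s)\<^sup>2 = - s * N\<^sup>2"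
    unfolding N by algebra
  finally have "(cmod (cip \<psi> \<xi>))\<^sup>2 - (cmod (cip \<phi> \<xi>))\<^sup>2 = - s"
    using N(1) by simp
  moreover have "cip \<xi> (\<lambda>i. \<Sum>j\<in>UNIV. (pure_state \<psi> i j - pure_state \<phi> i j) * \<xi> j)
      = cip \<xi> (\<lambda>i. \<Sum>j\<in>UNIV. pure_state \<psi> i j * \<xi> j) - cip \<xi> (\<lambda>i. \<Sum>j\<in>UNIV. pure_state \<phi> i j * \<xi> j)"
    by (simp only: cip_diff_right[symmetric] sum_subtractf[symmetric] left_diff_distrib)
  moreover have "mtrace (\<lambda>i j. pure_state \<psi> i j - pure_state \<phi> i j) = 0"
    using mtrace_pure[of \<psi>] mtrace_pure[of \<phi>] \<psi> \<phi> by (simp add: mtrace_def sum_subtractf)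
  ultimately show ?thesis
    using trace_norm_ge_reflection[OF \<xi>, of "\<lambda>i j. pure_state \<psi> i j - pure_state \<phi> i j"]
    by (simp add: cip_pure_state)
qed

section \<open>Diamond norm of combinations of unitary channels\<close>

lemma sum_UNIV_bool: "(\<Sum>b\<in>(UNIV::bool set). f b) = f False + f True"
  by (simp add: UNIV_bool)

lemma sum_UNIV_prod: "(\<Sum>x\<in>UNIV. f x) = (\<Sum>a\<in>UNIV. \<Sum>b\<in>UNIV. f (a, b))"
  by (simp add: sum.cartesian_product flip: UNIV_Times_UNIV)

definition lift :: "bool cmat \<Rightarrow> (bool \<times> bool) cmat" where
  "lift V = (\<lambda>(a,b) (a',b'). if a = a' then V b b' else 0)"

lemma lift_mmult: "mmult (lift A) (lift B) = lift (mmult A B)"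
  by (auto simp: mmult_def lift_def fun_eq_iff sum_UNIV_prod sum_UNIV_bool)

lemma adj_lift: "adj (lift A) = lift (adj A)"
  by (auto simp: adj_def lift_def fun_eq_iff)

lemma lift_idm: "lift idm = idm"
  by (auto simp: idm_def lift_def fun_eq_iff)

lemma unitary_mat_lift: "unitary_mat V \<Longrightarrow> unitary_mat (lift V)"
  by (simp add: unitary_mat_def adj_lift lift_mmult lift_idm)

lemma id_tensor_uchan: "id_tensor (uchan V) X = mmult (mmult (lift V) X) (adj (lift V))"
  by (auto simp: id_tensor_def uchan_def adj_lift fun_eq_iff mmult_def lift_def adj_def
      sum_UNIV_prod sum_UNIV_bool)

text \<open>The triangle inequality combined with unitary invariance. The bound depends only on the
  coefficients, so it serves both as an estimate of the diamond norm and as the boundedness behind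
  its supremum.\<close>

lemma trace_norm_lincomb_uchan_le:
  assumes "finite K" "\<And>k. k \<in> K \<Longrightarrow> unitary_mat (V k)"
    and \<Phi>: "\<And>\<rho> r s. \<Phi> \<rho> r s = (\<Sum>k\<in>K. complex_of_real (c k) * uchan (V k) \<rho> r s)"
    and X: "trace_norm X \<le> 1"
  shows "trace_norm (id_tensor \<Phi> X) \<le> (\<Sum>k\<in>K. \<bar>c k\<bar>)"
proof -
  have "id_tensor \<Phi> X = (\<lambda>i j. \<Sum>k\<in>K. complex_of_real (c k) * id_tensor (uchan (V k)) X i j)"
    by (auto simp: id_tensor_def \<Phi> fun_eq_iff)
  hence "trace_norm (id_tensor \<Phi> X) \<le> (\<Sum>k\<in>K. \<bar>c k\<bar> * trace_norm (id_tensor (uchan (V k)) X))"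
    using trace_norm_sum_le[OF \<open>finite K\<close>] by simp
  also have "\<dots> \<le> (\<Sum>k\<in>K. \<bar>c k\<bar> * 1)"
  proof (intro sum_mono mult_left_mono)
    fix k assume "k \<in> K"
    hence "trace_norm (id_tensor (uchan (V k)) X) \<le> trace_norm X"
      unfolding id_tensor_uchan by (intro trace_norm_unitary_conj unitary_mat_lift assms)
    with X show "trace_norm (id_tensor (uchan (V k)) X) \<le> 1" by simp
  qed simp
  finally show ?thesis by simp
qed

text \<open>The zero operator makes the set under the supremum in \<open>diamond_norm\<close>
  nonempty.\<close>

lemma trace_norm_zero: "trace_norm (\<lambda>i j. 0) \<le> 1"
  by (rule trace_norm_leI) (simp add: mtrace_def mmult_def)

lemma diamond_norm_lincomb_uchan_le:
  assumes "finite K" "\<And>k. k \<in> K \<Longrightarrow> unitary_mat (V k)"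
    and "\<And>\<rho> r s. \<Phi> \<rho> r s = (\<Sum>k\<in>K. complex_of_real (c k) * uchan (V k) \<rho> r s)"
  shows "diamond_norm \<Phi> \<le> (\<Sum>k\<in>K. \<bar>c k\<bar>)"
  unfolding diamond_norm_def
  using trace_norm_lincomb_uchan_le[OF assms] trace_norm_zero
  by (intro cSup_least) auto

lemma diamond_norm_lincomb_uchan_ge:
  assumes "finite K" "\<And>k. k \<in> K \<Longrightarrow> unitary_mat (V k)"
    and "\<And>\<rho> r s. \<Phi> \<rho> r s = (\<Sum>k\<in>K. complex_of_real (c k) * uchan (V k) \<rho> r s)"
    and "trace_norm X \<le> 1"
  shows "trace_norm (id_tensor \<Phi> X) \<le> diamond_norm \<Phi>"
  unfolding diamond_norm_def
proof (rule cSup_upper)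
  show "bdd_above {trace_norm (id_tensor \<Phi> X) |X. trace_norm X \<le> 1}"
    using trace_norm_lincomb_uchan_le[OF assms(1-3)] by (auto intro!: bdd_aboveI)
qed (use assms(4) in auto)

lemma uchan_mmult: "uchan A (uchan B \<rho>) = uchan (mmult A B) \<rho>"
  by (simp add: uchan_def adj_mmult mmult_assoc)

lemma uchan_idm: "uchan idm \<rho> = \<rho>"
  by (simp add: uchan_def)

section \<open>Magic basis coordinates\<close>

text \<open>The Choi vector \<open>(1 \<otimes> V) |\<Omega>> / \<surd>2\<close>.\<close>
definition choi_vec :: "bool cmat \<Rightarrow> bool \<times> bool \<Rightarrow> complex" where
  "choi_vec V = (\<lambda>(a,b). V b a / complex_of_real (sqrt 2))"

lemma sqrt2_mult: "complex_of_real (sqrt 2) * complex_of_real (sqrt 2) = 2"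
  by (simp flip: of_real_mult)

lemma choi_uchan: "choi (uchan V) x y = 2 * pure_state (choi_vec V) x y"
  by (cases x; cases y)
    (simp add: choi_def id_tensor_def Omega_def uchan_def mmult_def adj_def pure_state_def
      choi_vec_def sum_UNIV_bool sqrt2_mult)

text \<open>Applying \<open>A\<close> to the second factor composes it with \<open>B\<close>. For
  \<open>B = adj U\<close> this means that feeding a channel the rotated maximally entangled state
  yields the normalised Choi state of the channel followed after the inverse of
  \<open>U\<close>.\<close>

lemma id_tensor_uchan_choi_vec:
  "id_tensor (uchan A) (pure_state (choi_vec B)) = pure_state (choi_vec (mmult A B))"
  by (auto simp: id_tensor_def uchan_def mmult_def adj_def pure_state_def fun_eq_iff
      choi_vec_def sum_UNIV_bool sqrt2_mult field_simps)

lemma cip_choi_vec: "cip (choi_vec A) (choi_vec B) = mtrace (mmult (adj A) B) / 2"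
  by (simp add: cip_def choi_vec_def mtrace_def mmult_def adj_def sum_UNIV_prod sum_UNIV_bool
      sqrt2_mult add_divide_distrib)

lemma cip_choi_vec_self: "unitary_mat V \<Longrightarrow> cip (choi_vec V) (choi_vec V) = 1"
  by (simp add: cip_choi_vec unitary_mat_def mtrace_def idm_def sum_UNIV_bool)

lemma sum_1_4: "(\<Sum>a\<in>{1..4::nat}. f a) = f 1 + f 2 + f 3 + f 4"
  by (simp add: eval_nat_numeral)

lemma ball_1_4: "(\<forall>a\<in>{1..4::nat}. P a) \<longleftrightarrow> P 1 \<and> P 2 \<and> P 3 \<and> P 4"
  by (auto simp: eval_nat_numeral le_Suc_eq)

lemma sum_0_3: "(\<Sum>a\<in>{0..3::nat}. f a) = f 0 + f 1 + f 2 + f 3"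
  by (simp add: eval_nat_numeral)

lemma ball_0_3: "(\<forall>a\<in>{0..3::nat}. P a) \<longleftrightarrow> P 0 \<and> P 1 \<and> P 2 \<and> P 3"
  by (auto simp: eval_nat_numeral le_Suc_eq)

definition mcoord :: "nat \<Rightarrow> bool cmat \<Rightarrow> complex" where
  "mcoord a V = cip (magic a) (choi_vec V)"

lemma mcoord_simps:
  "mcoord 1 V = (V False False + V True True) / 2"
  "mcoord 2 V = - \<i> * (V False False - V True True) / 2"
  "mcoord 3 V = - \<i> * (V False True + V True False) / 2"
  "mcoord 4 V = (V True False - V False True) / 2"
  by (simp_all add: mcoord_def cip_def magic_def choi_vec_def sum_UNIV_prod sum_UNIV_bool
      sqrt2_mult field_simps)

lemma in_MB_choi_uchan: "in_MB (choi (uchan V)) a b / 2 = mcoord a V * cnj (mcoord b V)"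
proof -
  have "in_MB (choi (uchan V)) a b / 2
      = (\<Sum>x\<in>UNIV. \<Sum>y\<in>UNIV. (cnj (magic a x) * choi_vec V x) * (magic b y * cnj (choi_vec V y)))"
    by (simp add: in_MB_def choi_uchan pure_state_def sum_divide_distrib mult_ac)
  thus ?thesis
    unfolding mcoord_def cip_def cnj_sum complex_cnj_mult complex_cnj_cnj sum_product by simp
qed

text \<open>Parseval's identity for the orthonormal magic basis, verified coordinate by
  coordinate.\<close>

lemma cip_choi_vec_mcoord:
  "cip (choi_vec A) (choi_vec B) = (\<Sum>a\<in>{1..4}. cnj (mcoord a A) * mcoord a B)"
  unfolding sum_1_4 mcoord_simps cip_choi_vec
  by (simp add: mtrace_def mmult_def adj_def sum_UNIV_bool field_simps)

text \<open>Dividing \<open>V\<close> by a square root \<open>u\<close> of its determinant gives an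
  element of SU(2), and SU(2) is the real unit sphere in magic coordinates. The phase
  \<open>u\<close> cancels in every product \<open>mcoord a V * cnj (mcoord b V)\<close>.\<close>

lemma unitary_mcoord_real:
  assumes "unitary_mat V"
  obtains u r where "cmod u = 1" "\<And>a. a \<in> {1..4} \<Longrightarrow> mcoord a V = u * complex_of_real (r a)"
    "(\<Sum>a\<in>{1..4}. (r a)\<^sup>2) = 1"
proof -
  let ?a = "V False False" and ?b = "V False True" and ?c = "V True False" and ?d = "V True True"
  define d where "d = ?a * ?d - ?b * ?c"
  have VV: "mmult (adj V) V i j = idm i j" "mmult V (adj V) i j = idm i j" for i j
    using assms by (simp_all add: unitary_matD unitary_mat_adj_right)
  have e: "cnj ?a * ?a + cnj ?c * ?c = 1" "cnj ?a * ?b + cnj ?c * ?d = 0"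
     "cnj ?b * ?b + cnj ?d * ?d = 1" "cnj ?b * ?a + cnj ?d * ?c = 0"
    using VV(1)[of False False] VV(1)[of False True] VV(1)[of True True] VV(1)[of True False]
    by (simp_all add: mmult_def adj_def sum_UNIV_bool idm_def)
  \<comment> \<open>The inverse of \<open>V\<close> is its adjoint and also its adjugate divided by
    the determinant \<open>d\<close>; comparing the two expresses the second row through conjugates
    of the first.\<close>
  have dd: "?d = d * cnj ?a" "?c = - d * cnj ?b"
    unfolding d_def using e by algebra+
  have "cnj d * d = 1"
    unfolding d_def complex_cnj_diff complex_cnj_mult using e by algebra
  hence "cmod d = 1"
    using complex_norm_square[of d] by (simp add: mult.commute abs_square_eq_1 flip: of_real_power)
  define u where "u = csqrt d"
  have uu: "d = u * u" 
    by (simp add: u_def flip: power2_eq_square)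
  have u: "cmod u = 1"
    using \<open>cmod d = 1\<close> by (simp add: u_def norm_csqrt)
  hence u1: "u * cnj u = 1"
    using complex_norm_square[of u] by simp
  define r where "r a = Re (cnj u * mcoord a V)" for a
  have "Im (cnj u * mcoord a V) = 0" if "a \<in> {1..4}" for a
  proof -
    \<comment> \<open>Taken with \<open>y = x\<close>: a number fixed by conjugation followed by
      multiplication with \<open>u * u\<close> becomes real after multiplication by
      \<open>cnj u\<close>. The magic coordinates have this property because
      \<open>d = u * u\<close>.\<close>
    have cu: "cnj (cnj u * x) = cnj u * y" if "cnj x * (u * u) = y" for x y
      using that u1 by (metis complex_cnj_cnj complex_cnj_mult mult.commute mult.left_commute mult_1)
    have "cnj (cnj u * mcoord a V) = cnj u * mcoord a V"
    proof (rule cu)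
      have "d * cnj d = 1" using \<open>cnj d * d = 1\<close> by (simp add: mult.commute)
      hence "cnj (mcoord 1 V) * d = mcoord 1 V" "cnj (mcoord 2 V) * d = mcoord 2 V"
        "cnj (mcoord 3 V) * d = mcoord 3 V" "cnj (mcoord 4 V) * d = mcoord 4 V"
        unfolding mcoord_simps dd by (simp_all add: field_simps)
      thus "cnj (mcoord a V) * (u * u) = mcoord a V"
        using that unfolding uu[symmetric] by (auto simp: eval_nat_numeral le_Suc_eq)
    qed
    thus ?thesis
      by (simp add: complex_eq_iff)
  qed
  hence r: "mcoord a V = u * complex_of_real (r a)" if "a \<in> {1..4}" for a
    using that u1 unfolding r_def
    by (metis complex_is_Real_iff mult.assoc mult_1 of_real_Re)
  have "1 = (\<Sum>a\<in>{1..4}. cnj (mcoord a V) * mcoord a V)"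
    using cip_choi_vec_self[OF assms] by (simp add: cip_choi_vec_mcoord)
  also have "\<dots> = (\<Sum>a\<in>{1..4}. (u * cnj u) * complex_of_real ((r a)\<^sup>2))"
    by (intro sum.cong refl) (simp add: r power2_eq_square mult_ac)
  also have "\<dots> = complex_of_real (\<Sum>a\<in>{1..4}. (r a)\<^sup>2)"
    by (simp add: u1)
  finally have "(\<Sum>a\<in>{1..4}. (r a)\<^sup>2) = 1"
    by (metis of_real_eq_1_iff)
  with u r show ?thesis by (rule that)
qed

section \<open>Convex combinations and the seven directions\<close>

text \<open>Weights are attached to indices rather than to points, so that coinciding points may
  carry separate weights and \<open>p\<close> can be read as a distribution on \<open>I\<close>. One
  inclusion holds because such combinations form a convex set containing every
  \<open>f i\<close>.\<close>

lemma convex_hull_image_finite: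
  fixes f :: "'i \<Rightarrow> 'a::real_vector"
  assumes "finite I"
  shows "y \<in> convex hull (f ` I) \<longleftrightarrow>
    (\<exists>p. (\<forall>i\<in>I. 0 \<le> p i) \<and> sum p I = 1 \<and> (\<Sum>i\<in>I. p i *\<^sub>R f i) = y)"
proof
  let ?T = "{y. \<exists>p. (\<forall>i\<in>I. 0 \<le> p i) \<and> sum p I = 1 \<and> (\<Sum>i\<in>I. p i *\<^sub>R f i) = y}"
  have "convex ?T"
  proof (rule convexI)
    fix y z and u v :: real
    assume uv: "0 \<le> u" "0 \<le> v" "u + v = 1" and "y \<in> ?T" "z \<in> ?T"
    then obtain p q where
      p: "\<forall>i\<in>I. 0 \<le> p i" "sum p I = 1" "(\<Sum>i\<in>I. p i *\<^sub>R f i) = y" and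
      q: "\<forall>i\<in>I. 0 \<le> q i" "sum q I = 1" "(\<Sum>i\<in>I. q i *\<^sub>R f i) = z"
      by blast
    have "(\<Sum>i\<in>I. (u * p i + v * q i) *\<^sub>R f i) = u *\<^sub>R y + v *\<^sub>R z"
      by (simp add: p(3)[symmetric] q(3)[symmetric] scaleR_add_left sum.distrib scaleR_sum_right)
    moreover have "(\<Sum>i\<in>I. u * p i + v * q i) = 1"
      using uv p q by (simp add: sum.distrib flip: sum_distrib_left)
    moreover have "\<forall>i\<in>I. 0 \<le> u * p i + v * q i"
      using uv p q by simp
    ultimately show "u *\<^sub>R y + v *\<^sub>R z \<in> ?T"
      by (intro CollectI exI[of _ "\<lambda>i. u * p i + v * q i"]) simp
  qed
  moreover have "f ` I \<subseteq> ?T"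
  proof
    fix y assume "y \<in> f ` I"
    then obtain i where i: "i \<in> I" "y = f i" by blast
    let ?p = "\<lambda>k. if k = i then 1 else 0 :: real"
    have "(\<Sum>k\<in>I. ?p k *\<^sub>R f k) = (\<Sum>k\<in>I. if k = i then f k else 0)"
      by (intro sum.cong) auto
    with i assms show "y \<in> ?T"
      by (intro CollectI exI[of _ ?p]) simp
  qed
  ultimately have "convex hull (f ` I) \<subseteq> ?T"
    by (intro hull_minimal)
  thus "\<exists>p. (\<forall>i\<in>I. 0 \<le> p i) \<and> sum p I = 1 \<and> (\<Sum>i\<in>I. p i *\<^sub>R f i) = y"
    if "y \<in> convex hull (f ` I)"
    using that by blast
next
  assume "\<exists>p. (\<forall>i\<in>I. 0 \<le> p i) \<and> sum p I = 1 \<and> (\<Sum>i\<in>I. p i *\<^sub>R f i) = y"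
  then obtain p where "\<forall>i\<in>I. 0 \<le> p i" "sum p I = 1" "(\<Sum>i\<in>I. p i *\<^sub>R f i) = y"
    by blast
  moreover from this have "(\<Sum>i\<in>I. p i *\<^sub>R f i) \<in> convex hull (f ` I)"
    using assms by (intro convex_sum[OF assms convex_convex_hull]) (auto intro: hull_inc)
  ultimately show "y \<in> convex hull (f ` I)"
    by simp
qed

text \<open>The pairs of constraint value and cost, over all weights, fill the convex hull of the
  points \<open>(x i, t i)\<close>. This hull is compact, and so is its slice at constraint value 0,
  on which the cost coordinate attains its minimum.\<close>

lemma exists_min_convex_weights:
  fixes x :: "'i \<Rightarrow> 'a::euclidean_space" and t :: "'i \<Rightarrow> real"
  assumes "finite I"
    and ex: "(\<forall>i\<in>I. 0 \<le> p0 i) \<and> sum p0 I = 1 \<and> (\<Sum>i\<in>I. p0 i *\<^sub>R x i) = 0"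
  obtains p where "(\<forall>i\<in>I. 0 \<le> p i) \<and> sum p I = 1 \<and> (\<Sum>i\<in>I. p i *\<^sub>R x i) = 0"
    "\<And>q. (\<forall>i\<in>I. 0 \<le> q i) \<and> sum q I = 1 \<and> (\<Sum>i\<in>I. q i *\<^sub>R x i) = 0
      \<Longrightarrow> (\<Sum>i\<in>I. p i * t i) \<le> (\<Sum>i\<in>I. q i * t i)"
proof -
  let ?f = "\<lambda>i. (x i, t i)"
  let ?H = "convex hull (?f ` I) \<inter> ({0} \<times> UNIV)"
  have sum_f: "(\<Sum>i\<in>I. p i *\<^sub>R ?f i) = (\<Sum>i\<in>I. p i *\<^sub>R x i, \<Sum>i\<in>I. p i * t i)" for p
    by (simp add: prod_eq_iff fst_sum snd_sum)
  have H: "(y, s) \<in> ?H \<longleftrightarrow> (\<exists>p. (\<forall>i\<in>I. 0 \<le> p i) \<and> sum p I = 1 \<and> (\<Sum>i\<in>I. p i *\<^sub>R x i) = 0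
      \<and> y = 0 \<and> s = (\<Sum>i\<in>I. p i * t i))" for y s
    unfolding Int_iff convex_hull_image_finite[OF \<open>finite I\<close>] sum_f by auto
  have "compact ?H"
    using \<open>finite I\<close>
    by (intro compact_Int_closed finite_imp_compact_convex_hull closed_Times) auto
  moreover have "(0, \<Sum>i\<in>I. p0 i * t i) \<in> ?H"
    unfolding H using ex by blast
  moreover have "continuous_on ?H snd"
    by (intro continuous_intros)
  ultimately obtain z where z: "z \<in> ?H" "\<forall>w\<in>?H. snd z \<le> snd w"
    using continuous_attains_inf[of ?H snd] by blast
  obtain y s where ys: "z = (y, s)" by (cases z)
  obtain p where p: "(\<forall>i\<in>I. 0 \<le> p i) \<and> sum p I = 1 \<and> (\<Sum>i\<in>I. p i *\<^sub>R x i) = 0"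
    "s = (\<Sum>i\<in>I. p i * t i)"
    using z(1) unfolding ys H by blast
  show ?thesis
  proof (rule that[OF p(1)])
    fix q assume "(\<forall>i\<in>I. 0 \<le> q i) \<and> sum q I = 1 \<and> (\<Sum>i\<in>I. q i *\<^sub>R x i) = 0"
    hence "(0, \<Sum>i\<in>I. q i * t i) \<in> ?H" unfolding H by blast
    from z(2)[rule_format, OF this]
    show "(\<Sum>i\<in>I. p i * t i) \<le> (\<Sum>i\<in>I. q i * t i)"
      by (simp add: ys p(2))
  qed
qed

text \<open>Positive weights and the spanning condition make \<open>0\<close> interior to the hull.
  Quantitatively, \<open>g\<close> is positive and continuous on the unit sphere, hence bounded
  below there, whereas a hyperplane separating \<open>0\<close> from a perturbed hull would give a
  unit direction in which \<open>g\<close> is too small.\<close>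

lemma zero_in_hull_stable:
  fixes x :: "'i \<Rightarrow> 'a::euclidean_space"
  assumes "finite I" and w: "\<And>i. i \<in> I \<Longrightarrow> 0 < w i" "(\<Sum>i\<in>I. w i *\<^sub>R x i) = 0"
    and span: "\<And>a. \<forall>i\<in>I. a \<bullet> x i = 0 \<Longrightarrow> a = 0"
  obtains \<delta> where "0 < \<delta>"
    "\<forall>x'. (\<forall>i\<in>I. norm (x' i - x i) < \<delta>) \<longrightarrow> 0 \<in> convex hull (x' ` I)"
proof -
  define g where "g a = (\<Sum>i\<in>I. w i * \<bar>a \<bullet> x i\<bar>)" for a
  have g_pos: "0 < g a" if "norm a = 1" for a
  proof -
    obtain i where "i \<in> I" "a \<bullet> x i \<noteq> 0"
      using span[of a] \<open>norm a = 1\<close> by force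
    thus ?thesis
      unfolding g_def using w(1) \<open>finite I\<close>
      by (intro sum_pos2[of _ i]) (auto simp: less_imp_le)
  qed
  obtain b0 :: 'a where b0: "b0 \<in> Basis" using nonempty_Basis by blast
  have "continuous_on (sphere 0 1) g"
    unfolding g_def by (intro continuous_intros)
  moreover have "sphere (0::'a) 1 \<noteq> {}"
    using b0 by auto
  ultimately obtain a0 where a0: "norm a0 = 1" "\<And>a. norm a = 1 \<Longrightarrow> g a0 \<le> g a"
    using continuous_attains_inf[of "sphere 0 1" g] by auto
  have "I \<noteq> {}"
    using span[of b0] b0 by auto
  hence W: "0 < sum w I"
    using w(1) \<open>finite I\<close> by (intro sum_pos) auto
  \<comment> \<open>Chosen so that total weight times \<open>2 * \<delta>\<close> is exactly the
    minimum of \<open>g\<close>.\<close>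
  define \<delta> where "\<delta> = g a0 / (2 * sum w I)"
  have "0 < \<delta>"
    using g_pos[OF a0(1)] W by (simp add: \<delta>_def)
  show ?thesis
  proof (intro that[OF \<open>0 < \<delta>\<close>] allI impI)
    fix x' :: "'i \<Rightarrow> 'a" assume x': "\<forall>i\<in>I. norm (x' i - x i) < \<delta>"
    show "0 \<in> convex hull (x' ` I)"
    proof (rule ccontr)
      assume "0 \<notin> convex hull (x' ` I)"
      moreover have "closed (convex hull (x' ` I))"
        using \<open>finite I\<close> by (intro compact_imp_closed finite_imp_compact_convex_hull) auto
      ultimately obtain a b where ab: "a \<noteq> 0" "0 < b" "\<forall>y\<in>convex hull (x' ` I). b < a \<bullet> y"
        using separating_hyperplane_closed_0[of "convex hull (x' ` I)"] convex_convex_hull by blast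
      define n where "n = a /\<^sub>R norm a"
      have n: "norm n = 1" using ab(1) by (simp add: n_def)
      have low: "- \<delta> < n \<bullet> x i" if "i \<in> I" for i
      proof -
        have "0 < a \<bullet> x' i"
          using ab(2,3) that by (smt (verit) hull_inc image_eqI)
        hence "0 < n \<bullet> x' i"
          using ab(1) by (simp add: n_def)
        moreover have "\<bar>n \<bullet> (x' i - x i)\<bar> \<le> norm n * norm (x' i - x i)"
          by (rule Cauchy_Schwarz_ineq2)
        ultimately show ?thesis
          using bspec[OF x' that] n by (simp add: inner_diff_right)
      qed
      have "(\<Sum>i\<in>I. w i * (n \<bullet> x i)) = n \<bullet> (\<Sum>i\<in>I. w i *\<^sub>R x i)"
        by (simp add: inner_sum_right)
      \<comment> \<open>Subtracting the inner products costs nothing, as their weighted sum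
        vanishes. What remains, \<open>\<bar>t\<bar> - t\<close>, is zero for
        \<open>t \<ge> 0\<close> and below \<open>2 * \<delta>\<close> for negative \<open>t\<close>
        above \<open>- \<delta>\<close>.\<close>
      hence "g n = (\<Sum>i\<in>I. w i * (\<bar>n \<bullet> x i\<bar> - n \<bullet> x i))"
        using w(2) by (simp add: g_def right_diff_distrib sum_subtractf)
      also have "\<dots> < (\<Sum>i\<in>I. w i * (2 * \<delta>))"
      proof (rule sum_strict_mono[OF \<open>finite I\<close> \<open>I \<noteq> {}\<close>])
        fix i assume "i \<in> I"
        hence "\<bar>n \<bullet> x i\<bar> - n \<bullet> x i < 2 * \<delta>"
          using low[of i] \<open>0 < \<delta>\<close> by linarith
        thus "w i * (\<bar>n \<bullet> x i\<bar> - n \<bullet> x i) < w i * (2 * \<delta>)"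
          using w(1)[OF \<open>i \<in> I\<close>] by (rule mult_strict_left_mono)
      qed
      also have "\<dots> = g a0"
        unfolding sum_distrib_right[symmetric] using W by (simp add: \<delta>_def)
      finally show False
        using a0(2)[OF n] by simp
    qed
  qed
qed

section \<open>The off-diagonal vector and the seven directions\<close>

type_synonym r6 = "real \<times> real \<times> real \<times> real \<times> real \<times> real"

text \<open>The entries above the diagonal of the symmetric matrix \<open>r r^T\<close>. A nested
  product of reals is a Euclidean space, so the hull lemmas above apply to it.\<close>

definition off_diag :: "(nat \<Rightarrow> real) \<Rightarrow> r6" where
  "off_diag r = (r 1 * r 2, r 1 * r 3, r 1 * r 4, r 2 * r 3, r 2 * r 4, r 3 * r 4)"

lemma sum_off_diag_eq_0_iff:
  "(\<Sum>j\<in>J. p j *\<^sub>R off_diag (r j)) = 0 \<longleftrightarrow>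
    (\<forall>a\<in>{1..4}. \<forall>b\<in>{1..4}. a \<noteq> b \<longrightarrow> (\<Sum>j\<in>J. p j * (r j a * r j b)) = 0)"
  unfolding ball_1_4
  by (auto simp: off_diag_def prod_eq_iff fst_sum snd_sum mult.commute)

text \<open>The point \<open>(3,3,3)\<close> and two cyclic orbits on the sphere of radius \<open>\<surd>27\<close>.  By cyclic symmetry a
  dependency with one weight per orbit only has to satisfy two equations, which gives 8, 7 and 9.\<close>
definition design_coords :: "nat \<Rightarrow> real \<times> real \<times> real" where
  "design_coords j =
    (if j = 1 then (3, 3, 3)
     else if j = 2 then (5, -1, -1)
     else if j = 3 then (-1, 5, -1)
     else if j = 4 then (-1, -1, 5)
     else if j = 5 then (-5, -1, 1)
     else if j = 6 then (1, -5, -1)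
     else (-1, 1, -5))"

definition design :: "nat \<Rightarrow> real^3" where
  "design j = (case design_coords j of (x, y, z) \<Rightarrow> vector [x / sqrt 27, y / sqrt 27, z / sqrt 27])"

text \<open>The limit of \<open>ehat\<close> for small \<open>c * \<epsilon>\<close> after its last
  three coordinates are divided by \<open>c * \<epsilon>\<close>; this is why the first coordinate
  is 1.\<close>

definition design_vec :: "nat \<Rightarrow> nat \<Rightarrow> real" where
  "design_vec j k = (if k = 1 then 1 else if k = 2 then design j $ 1
     else if k = 3 then design j $ 2 else design j $ 3)"

lemma atLeastAtMost_1_7: "{1..7::nat} = {1,2,3,4,5,6,7}"
  by auto

lemma norm_design: "norm (design j) = 1"
  by (simp add: design_def design_coords_def norm_eq_sqrt_inner inner_vec_def sum_3 vector_3
      power_divide flip: power2_eq_square)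

lemma sum_design: "(\<Sum>j\<in>{1..7}. (if j = 1 then 8 else if j \<le> 4 then 7 else 9) *\<^sub>R off_diag (design_vec j)) = 0"
  unfolding atLeastAtMost_1_7
  by (simp add: off_diag_def design_vec_def design_def design_coords_def vector_3
      zero_prod_def field_simps)

text \<open>The factor 27 clears the denominators of the quadratic terms, and the surviving
  \<open>sqrt 27\<close> is absorbed into the linear unknowns. All coefficients then become
  integers.\<close>

lemma inner_off_diag_design:
  "27 * ((a1, a2, a3, b1, b2, b3) \<bullet> off_diag (design_vec j)) =
    (case design_coords j of (x, y, z) \<Rightarrow>
      (sqrt 27 * a1) * x + (sqrt 27 * a2) * y + (sqrt 27 * a3) * z + b1 * (x * y) + b2 * (x * z) + b3 * (y * z))"
proof -
  obtain x y z where xyz: "design_coords j = (x, y, z)"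
    by (metis prod.exhaust)
  show ?thesis
    by (simp add: xyz off_diag_def design_vec_def design_def vector_3 field_simps)
qed

text \<open>No hyperplane through the origin contains all seven points: the resulting integer system
  of seven equations in six rescaled unknowns has full rank.\<close>

lemma design_span:
  assumes "\<forall>j\<in>{1..7}. a \<bullet> off_diag (design_vec j) = 0"
  shows "a = 0"
proof -
  obtain a1 a2 a3 b1 b2 b3 where a: "a = (a1, a2, a3, b1, b2, b3)"
    by (metis prod.exhaust)
  define A1 A2 A3 where A: "A1 = sqrt 27 * a1" "A2 = sqrt 27 * a2" "A3 = sqrt 27 * a3"
  have eq: "case design_coords j of (x, y, z) \<Rightarrow>
      A1 * x + A2 * y + A3 * z + b1 * (x * y) + b2 * (x * z) + b3 * (y * z) = 0" if "j \<in> {1..7}" for j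
    using bspec[OF assms that] inner_off_diag_design[of a1 a2 a3 b1 b2 b3 j] by (simp add: a A split: prod.splits)
  have "3 * A1 + 3 * A2 + 3 * A3 + 9 * b1 + 9 * b2 + 9 * b3 = 0"
    using eq[of 1] by (simp add: design_coords_def)
  moreover have "5 * A1 - A2 - A3 - 5 * b1 - 5 * b2 + b3 = 0"
    using eq[of 2] by (simp add: design_coords_def)
  moreover have "- A1 + 5 * A2 - A3 - 5 * b1 + b2 - 5 * b3 = 0"
    using eq[of 3] by (simp add: design_coords_def)
  moreover have "- A1 - A2 + 5 * A3 + b1 - 5 * b2 - 5 * b3 = 0"
    using eq[of 4] by (simp add: design_coords_def)
  moreover have "- 5 * A1 - A2 + A3 + 5 * b1 - 5 * b2 - b3 = 0"
    using eq[of 5] by (simp add: design_coords_def)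
  moreover have "A1 - 5 * A2 - A3 - 5 * b1 - b2 + 5 * b3 = 0"
    using eq[of 6] by (simp add: design_coords_def)
  moreover have "- A1 + A2 - 5 * A3 - b1 + 5 * b2 - 5 * b3 = 0"
    using eq[of 7] by (simp add: design_coords_def)
  ultimately have "A1 = 0" "A2 = 0" "A3 = 0" "b1 = 0" "b2 = 0" "b3 = 0"
    by linarith+
  thus ?thesis
    by (simp add: a A zero_prod_def)
qed

section \<open>Perturbation of a single coordinate vector\<close>

text \<open>The hypotheses \<open>S\<close> say that the angle between the unit vectors
  \<open>ehat\<close> and \<open>r\<close> has sine at most \<open>\<epsilon>\<close>. The angle to
  the first axis therefore changes by at most \<open>arcsin \<epsilon>\<close>, which gives the
  first two bounds; the third comes from the Euclidean distance of the vectors. The argument is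
  carried out with sines and cosines only.\<close>

lemma ehat_perturbation:
  assumes v: "norm v = 1" and c: "1 \<le> c" and \<epsilon>: "0 < \<epsilon>" "c * \<epsilon> \<le> 1"
    and r: "(\<Sum>a\<in>{1..4}. (r a)\<^sup>2) = 1"
    and S: "0 \<le> (\<Sum>a\<in>{1..4}. ehat c \<epsilon> v a * r a)" "1 - \<epsilon>\<^sup>2 \<le> (\<Sum>a\<in>{1..4}. ehat c \<epsilon> v a * r a)\<^sup>2"
  shows "((c - 1) * \<epsilon>)\<^sup>2 \<le> 1 - (r 1)\<^sup>2" and "1 - (r 1)\<^sup>2 \<le> ((c + 1) * \<epsilon>)\<^sup>2"
    and "\<And>a. a \<in> {1..4} \<Longrightarrow> \<bar>ehat c \<epsilon> v a - r a\<bar> \<le> 2 * \<epsilon>"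
proof -
  define x where "x = c * \<epsilon>"
  define q where "q = sqrt (1 - x\<^sup>2)"
  define R where "R = sqrt (1 - (r 1)\<^sup>2)"
  define m where "m = v $ 1 * r 2 + v $ 2 * r 3 + v $ 3 * r 4"
  define k where "k = sqrt (1 - \<epsilon>\<^sup>2)"
  have x: "\<epsilon> \<le> x" "x \<le> 1" "0 < x"
    using c \<epsilon> mult_right_mono[of 1 c \<epsilon>] by (auto simp: x_def)
  have xx: "x\<^sup>2 \<le> 1" "\<epsilon>\<^sup>2 \<le> x\<^sup>2"
    using x \<epsilon> by (simp_all add: power_mono power_le_one)
  have q: "0 \<le> q" "q\<^sup>2 = 1 - x\<^sup>2" "q \<le> 1" and k: "0 \<le> k" "k\<^sup>2 = 1 - \<epsilon>\<^sup>2" "k \<le> 1" "q \<le> k"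
    using xx by (auto simp: q_def k_def)
  have rr: "(r 1)\<^sup>2 + ((r 2)\<^sup>2 + (r 3)\<^sup>2 + (r 4)\<^sup>2) = 1"
    using r unfolding sum_1_4 by simp
  hence r1: "(r 1)\<^sup>2 \<le> 1"
    using zero_le_power2[of "r 2"] zero_le_power2[of "r 3"] zero_le_power2[of "r 4"] by linarith
  hence R: "0 \<le> R" "R\<^sup>2 = 1 - (r 1)\<^sup>2"
    by (simp_all add: R_def)
  hence R': "R\<^sup>2 = (r 2)\<^sup>2 + (r 3)\<^sup>2 + (r 4)\<^sup>2"
    using rr by linarith
  have vv: "(v $ 1)\<^sup>2 + (v $ 2)\<^sup>2 + (v $ 3)\<^sup>2 = 1"
    using v by (simp add: norm_eq_sqrt_inner inner_vec_def sum_3 power2_eq_square)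
  \<comment> \<open>Lagrange's identity, which yields the Cauchy-Schwarz bound for the vector
    parts.\<close>
  have "R\<^sup>2 - m\<^sup>2 = (v $ 1 * r 3 - v $ 2 * r 2)\<^sup>2 + (v $ 1 * r 4 - v $ 3 * r 2)\<^sup>2 + (v $ 2 * r 4 - v $ 3 * r 3)\<^sup>2"
    unfolding R' m_def using vv by algebra
  hence "m\<^sup>2 \<le> R\<^sup>2"
    by (smt (verit) zero_le_power2)
  hence mR: "m \<le> R"
    using R(1) by (rule power2_le_imp_le)
  define T where "T = (\<Sum>a\<in>{1..4}. ehat c \<epsilon> v a * r a)"
  have T: "T = r 1 * q + x * m"
    unfolding T_def sum_1_4 by (simp add: ehat_def m_def q_def x_def algebra_simps)
  \<comment> \<open>Here \<open>x\<close>, \<open>q\<close> are sine and cosine of the angle of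
    \<open>ehat\<close> to the first axis, and \<open>R\<close>, \<open>\<bar>r 1\<bar>\<close>
    those for \<open>r\<close>. Hence \<open>\<alpha>\<close> and \<open>D\<close> are cosine and
    sine of the difference of the two angles.\<close>
  define \<alpha> where "\<alpha> = \<bar>r 1\<bar> * q + x * R"
  define D where "D = R * q - x * \<bar>r 1\<bar>"
  have "r 1 * q \<le> \<bar>r 1\<bar> * q" "x * m \<le> x * R"
    using q(1) mR x(3) by (auto intro!: mult_right_mono mult_left_mono)
  hence T\<alpha>: "T \<le> \<alpha>"
    unfolding T \<alpha>_def by linarith
  have k_T: "k \<le> T"
  proof (rule power2_le_imp_le)
    show "k\<^sup>2 \<le> T\<^sup>2"
      unfolding k(2) T_def by (rule S(2))
    show "0 \<le> T"
      unfolding T_def by (rule S(1))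
  qed
  have \<alpha>: "k \<le> \<alpha>"
    using k_T T\<alpha> by simp
  have "\<bar>r 1\<bar>\<^sup>2 + R\<^sup>2 = 1"
    using R(2) by simp
  hence D\<alpha>: "D\<^sup>2 + \<alpha>\<^sup>2 = 1"
  proof -
    have "D\<^sup>2 + \<alpha>\<^sup>2 = (\<bar>r 1\<bar>\<^sup>2 + R\<^sup>2) * (q\<^sup>2 + x\<^sup>2)"
      unfolding D_def \<alpha>_def by algebra
    thus ?thesis using q(2) \<open>\<bar>r 1\<bar>\<^sup>2 + R\<^sup>2 = 1\<close> by simp
  qed
  have "\<alpha>\<^sup>2 \<le> 1\<^sup>2"
    using D\<alpha> by (smt (verit) zero_le_power2 one_power2)
  hence \<alpha>1: "\<alpha> \<le> 1"
    by (rule power2_le_imp_le) simp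
  have "k\<^sup>2 \<le> \<alpha>\<^sup>2"
    using \<alpha> k(1) by (rule power_mono)
  hence "D\<^sup>2 \<le> \<epsilon>\<^sup>2"
    using D\<alpha> k(2) by linarith
  hence D: "\<bar>D\<bar> \<le> \<epsilon>"
    using \<epsilon>(1) by (simp add: abs_le_square_iff[symmetric])
  \<comment> \<open>The addition formula for the sine recovers \<open>R\<close> from the angle of
    \<open>ehat\<close> and the difference.\<close>
  have RD: "R = x * \<alpha> + D * q"
    unfolding D_def \<alpha>_def using q(2) by algebra
  have "D * q \<le> \<epsilon> * 1"
    using D q \<epsilon>(1) by (intro mult_mono) auto
  moreover have "x * \<alpha> \<le> x * 1"
    using x \<alpha>1 by (intro mult_left_mono) auto
  ultimately have "R \<le> (c + 1) * \<epsilon>"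
    unfolding RD by (simp add: x_def algebra_simps)
  hence "R\<^sup>2 \<le> ((c + 1) * \<epsilon>)\<^sup>2"
    using R(1) by (rule power_mono)
  thus "1 - (r 1)\<^sup>2 \<le> ((c + 1) * \<epsilon>)\<^sup>2"
    using R(2) by simp
  \<comment> \<open>The extreme case for the lower bound is \<open>x * k - \<epsilon> * q\<close>,
    the sine of \<open>arcsin x - arcsin \<epsilon>\<close>, which is still at least
    \<open>x - \<epsilon>\<close>.\<close>
  have "- \<epsilon> * q \<le> D * q"
    using D q(1) by (intro mult_right_mono) auto
  moreover have "x * k \<le> x * \<alpha>"
    using x \<alpha> by (intro mult_left_mono) auto
  moreover have "x - \<epsilon> \<le> x * k - \<epsilon> * q"
  proof -
    \<comment> \<open>\<open>1 - k = \<epsilon>\<^sup>2 / (1 + k)\<close> and \<open>1 - q = x\<^sup>2 / (1 + q)\<close>.\<close>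
    have "x * (1 - k) * ((1 + k) * (1 + q)) = \<epsilon> * x * (\<epsilon> * (1 + q))"
      using k(2) by algebra
    also have "\<dots> \<le> \<epsilon> * x * (x * (1 + k))"
      using x \<epsilon>(1) k q by (intro mult_left_mono mult_mono) auto
    also have "\<dots> = \<epsilon> * (1 - q) * ((1 + k) * (1 + q))"
      using q(2) by algebra
    finally have "x * (1 - k) \<le> \<epsilon> * (1 - q)"
      using k(1) q(1) by (simp add: mult_le_cancel_right add_pos_nonneg)
    thus ?thesis by (simp add: algebra_simps)
  qed
  ultimately have "(c - 1) * \<epsilon> \<le> R"
    unfolding RD by (simp add: x_def algebra_simps)
  moreover have "0 \<le> (c - 1) * \<epsilon>"
    using c \<epsilon> by simp
  ultimately have "((c - 1) * \<epsilon>)\<^sup>2 \<le> R\<^sup>2"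
    by (intro power_mono)
  thus "((c - 1) * \<epsilon>)\<^sup>2 \<le> 1 - (r 1)\<^sup>2"
    using R(2) by simp
  have ee: "(\<Sum>a\<in>{1..4}. (ehat c \<epsilon> v a)\<^sup>2) = 1"
  proof -
    have "(\<Sum>a\<in>{1..4}. (ehat c \<epsilon> v a)\<^sup>2) = q\<^sup>2 + x\<^sup>2 * ((v $ 1)\<^sup>2 + (v $ 2)\<^sup>2 + (v $ 3)\<^sup>2)"
      unfolding sum_1_4 by (simp add: ehat_def q_def x_def algebra_simps)
    thus ?thesis by (simp add: vv q(2))
  qed
  have "(\<Sum>a\<in>{1..4}. (ehat c \<epsilon> v a - r a)\<^sup>2)
      = (\<Sum>a\<in>{1..4}. (ehat c \<epsilon> v a)\<^sup>2) + (\<Sum>a\<in>{1..4}. (r a)\<^sup>2) - 2 * T"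
    unfolding T_def sum_1_4 by algebra
  also have "\<dots> = 2 - 2 * T"
    unfolding ee r by simp
  also have "\<dots> \<le> 2 * (1 - k)"
    using k_T by simp
  \<comment> \<open>Since \<open>0 \<le> k \<le> 1\<close>, passing to
    \<open>1 - k\<^sup>2 = \<epsilon>\<^sup>2\<close> only enlarges the bound and removes the square
    root.\<close>
  also have "1 - k \<le> (1 - k) * (1 + k)"
    using k by (simp add: algebra_simps) (use mult_right_mono[of k 1 k] in linarith)
  also have "(1 - k) * (1 + k) = \<epsilon>\<^sup>2"
    using k(2) by algebra
  finally have dist: "(\<Sum>a\<in>{1..4}. (ehat c \<epsilon> v a - r a)\<^sup>2) \<le> 2 * \<epsilon>\<^sup>2" by simp
  fix a :: nat assume "a \<in> {1..4}"
  hence "(ehat c \<epsilon> v a - r a)\<^sup>2 \<le> (\<Sum>a\<in>{1..4}. (ehat c \<epsilon> v a - r a)\<^sup>2)"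
    by (intro member_le_sum) auto
  also note dist
  also have "2 * \<epsilon>\<^sup>2 \<le> (2 * \<epsilon>)\<^sup>2" by (simp add: power_mult_distrib)
  finally have "\<bar>ehat c \<epsilon> v a - r a\<bar> \<le> \<bar>2 * \<epsilon>\<bar>"
    by (simp only: abs_le_square_iff)
  thus "\<bar>ehat c \<epsilon> v a - r a\<bar> \<le> 2 * \<epsilon>"
    using \<epsilon>(1) by simp
qed

section \<open>Pauli remnants\<close>

lemma in_MB_choi_lincomb_uchan:
  assumes "\<And>\<rho> r s. \<Phi> \<rho> r s = (\<Sum>k\<in>K. complex_of_real (c k) * uchan (V k) \<rho> r s)"
  shows "in_MB (choi \<Phi>) a b / 2 = (\<Sum>k\<in>K. complex_of_real (c k) * (mcoord a (V k) * cnj (mcoord b (V k))))"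
proof -
  have "choi \<Phi> x y = (\<Sum>k\<in>K. complex_of_real (c k) * choi (uchan (V k)) x y)" for x y
    by (cases x; cases y) (simp add: choi_def id_tensor_def assms)
  hence "in_MB (choi \<Phi>) a b = (\<Sum>x\<in>UNIV. \<Sum>y\<in>UNIV. \<Sum>k\<in>K.
      complex_of_real (c k) * (cnj (magic a x) * choi (uchan (V k)) x y * magic b y))"
    by (simp add: in_MB_def sum_distrib_left sum_distrib_right mult_ac)
  also have "\<dots> = (\<Sum>x\<in>UNIV. \<Sum>k\<in>K. \<Sum>y\<in>UNIV.
      complex_of_real (c k) * (cnj (magic a x) * choi (uchan (V k)) x y * magic b y))"
    by (intro sum.cong refl sum.swap)
  also have "\<dots> = (\<Sum>k\<in>K. \<Sum>x\<in>UNIV. \<Sum>y\<in>UNIV.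
      complex_of_real (c k) * (cnj (magic a x) * choi (uchan (V k)) x y * magic b y))"
    by (rule sum.swap)
  also have "\<dots> = (\<Sum>k\<in>K. complex_of_real (c k) * in_MB (choi (uchan (V k))) a b)"
    by (simp add: in_MB_def sum_distrib_left)
  finally have "in_MB (choi \<Phi>) a b / 2 = (\<Sum>k\<in>K. complex_of_real (c k) * (in_MB (choi (uchan (V k))) a b / 2))"
    by (simp add: sum_divide_distrib)
  thus ?thesis
    by (simp only: in_MB_choi_uchan)
qed

lemma adj_pauli: "adj (pauli k) = pauli k"
  by (auto simp: adj_def pauli_def fun_eq_iff)

lemma uchan_pauli: "uchan (pauli k) \<rho> = mmult (mmult (pauli k) \<rho>) (pauli k)"
  by (simp add: uchan_def adj_pauli)

lemma unitary_mat_pauli: "k \<in> {0..3} \<Longrightarrow> unitary_mat (pauli k)"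
  unfolding unitary_mat_def adj_pauli
  by (auto simp: mmult_def idm_def pauli_def fun_eq_iff sum_UNIV_bool)

lemma pauli_channel_iff_uchan:
  "pauli_channel E \<longleftrightarrow> (\<exists>chi::nat \<Rightarrow> real. (\<forall>k\<in>{0..3}. 0 \<le> chi k) \<and>
      (\<forall>\<rho> r s. E \<rho> r s = (\<Sum>k\<in>{0..3}. complex_of_real (chi k) * uchan (pauli k) \<rho> r s)))"
  by (simp add: pauli_channel_def uchan_pauli fun_eq_iff)

text \<open>The magic basis lists the Pauli matrices in the order \<open>I, Z, X, Y\<close>.\<close>
definition magic_pauli :: "nat \<Rightarrow> nat" where
  "magic_pauli a = (if a = 1 then 0 else if a = 2 then 3 else if a = 3 then 1 else 2)"

text \<open>Each Pauli matrix is a magic basis vector up to a phase, so it has a single nonzero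
  coordinate and Pauli channels have diagonal Choi matrices in the magic basis.\<close>

lemma mcoord_pauli:
  assumes "a \<in> {1..4}" "b \<in> {1..4}" "k \<in> {0..3}"
  shows "mcoord a (pauli k) * cnj (mcoord b (pauli k)) = (if a = b \<and> k = magic_pauli a then 1 else 0)"
proof -
  have "\<forall>a\<in>{1..4}. \<forall>b\<in>{1..4}. \<forall>k\<in>{0..3}.
      mcoord a (pauli k) * cnj (mcoord b (pauli k)) = (if a = b \<and> k = magic_pauli a then 1 else 0)"
    unfolding ball_1_4 ball_0_3 mcoord_simps by (simp add: pauli_def magic_pauli_def)
  with assms show ?thesis by blast
qed

text \<open>The matrix whose Choi vector is the \<open>a\<close>-th magic basis vector.\<close>
definition magic_mat :: "nat \<Rightarrow> bool cmat" where
  "magic_mat a = (\<lambda>r s. (if a = 1 then 1 else if a = 4 then - \<i> else \<i>) * pauli (magic_pauli a) r s)"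

lemma mcoord_expansion: "V r s = (\<Sum>a\<in>{1..4}. mcoord a V * magic_mat a r s)"
  unfolding sum_1_4 mcoord_simps
  by (cases r; cases s) (simp_all add: magic_mat_def magic_pauli_def pauli_def field_simps)

text \<open>Sesquilinear expansion of the channel in the magic matrices. It shows that the
  coordinate products alone determine the channel.\<close>

lemma uchan_mcoord:
  "uchan V \<rho> r s = (\<Sum>a\<in>{1..4}. \<Sum>b\<in>{1..4}. (mcoord a V * cnj (mcoord b V)) *
      mmult (mmult (magic_mat a) \<rho>) (adj (magic_mat b)) r s)"
proof -
  have l: "mmult V \<rho> r t = (\<Sum>a\<in>{1..4}. mcoord a V * mmult (magic_mat a) \<rho> r t)" for t
    by (simp only: mmult_def mcoord_expansion[of V] sum_UNIV_bool sum_1_4) (simp add: algebra_simps)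
  have "mmult A (adj B) r s = (\<Sum>t\<in>UNIV. A r t * cnj (B s t))" for A B :: "bool cmat"
    by (simp add: mmult_def adj_def)
  thus ?thesis
    by (simp only: uchan_def l mcoord_expansion[of V s] sum_UNIV_bool sum_1_4)
      (simp add: algebra_simps)
qed

lemma uchan_magic_mat:
  assumes "a \<in> {1..4}"
  shows "mmult (mmult (magic_mat a) \<rho>) (adj (magic_mat a)) = uchan (pauli (magic_pauli a)) \<rho>"
proof -
  define z where "z = (if a = 1 then 1 else if a = 4 then - \<i> else \<i>)"
  have "cnj z * z = 1" by (simp add: z_def)
  have magic_mat: "magic_mat a = (\<lambda>r s. z * pauli (magic_pauli a) r s)"
    by (simp add: magic_mat_def z_def)
  have "mmult (mmult (magic_mat a) \<rho>) (adj (magic_mat a)) r s = (cnj z * z) * uchan (pauli (magic_pauli a)) \<rho> r s" for r s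
    by (simp add: mmult_def magic_mat uchan_def adj_def sum_UNIV_bool algebra_simps)
  thus ?thesis
    by (simp add: fun_eq_iff \<open>cnj z * z = 1\<close>)
qed

text \<open>Necessity compares off-diagonal Choi entries, which vanish for a Pauli channel. For
  sufficiency the expansion of each channel in magic matrices loses its cross terms after averaging;
  the diagonal terms are Pauli conjugations with weights \<open>G a a\<close>, nonnegative as
  averages of squares.\<close>

lemma pauli_channel_lincomb_iff:
  assumes E: "\<And>\<rho> r s. E \<rho> r s = (\<Sum>j\<in>J. complex_of_real (p j) * uchan (W j) \<rho> r s)"
    and r: "\<And>j a b. j \<in> J \<Longrightarrow> a \<in> {1..4} \<Longrightarrow> b \<in> {1..4} \<Longrightarrow>
        mcoord a (W j) * cnj (mcoord b (W j)) = complex_of_real (r j a * r j b)"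
    and p: "\<And>j. j \<in> J \<Longrightarrow> 0 \<le> p j"
  shows "pauli_channel E \<longleftrightarrow> (\<Sum>j\<in>J. p j *\<^sub>R off_diag (r j)) = 0"
proof -
  have M: "in_MB (choi E) a b / 2 = complex_of_real (\<Sum>j\<in>J. p j * (r j a * r j b))"
    if "a \<in> {1..4}" "b \<in> {1..4}" for a b
    unfolding in_MB_choi_lincomb_uchan[OF E] using that by (simp add: r)
  show ?thesis
    unfolding sum_off_diag_eq_0_iff
  proof
    assume "pauli_channel E"
    then obtain chi :: "nat \<Rightarrow> real" where
      chi: "\<And>\<rho> r s. E \<rho> r s = (\<Sum>k\<in>{0..3}. complex_of_real (chi k) * uchan (pauli k) \<rho> r s)"
      unfolding pauli_channel_iff_uchan by blast
    show "\<forall>a\<in>{1..4}. \<forall>b\<in>{1..4}. a \<noteq> b \<longrightarrow> (\<Sum>j\<in>J. p j * (r j a * r j b)) = 0"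
    proof (intro ballI impI)
      fix a b :: nat assume ab: "a \<in> {1..4}" "b \<in> {1..4}" "a \<noteq> b"
      have "in_MB (choi E) a b / 2 = 0"
        unfolding in_MB_choi_lincomb_uchan[OF chi] using ab mcoord_pauli[OF ab(1,2)]
        by (intro sum.neutral) auto
      thus "(\<Sum>j\<in>J. p j * (r j a * r j b)) = 0"
        using M[OF ab(1,2)] by (metis of_real_eq_0_iff)
    qed
  next
    assume off: "\<forall>a\<in>{1..4}. \<forall>b\<in>{1..4}. a \<noteq> b \<longrightarrow> (\<Sum>j\<in>J. p j * (r j a * r j b)) = 0"
    define G where "G a b = (\<Sum>j\<in>J. p j * (r j a * r j b))" for a b
    have off': "G a b = 0" if "a \<in> {1..4}" "b \<in> {1..4}" "a \<noteq> b" for a b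
      using off that by (simp add: G_def)
    define T where "T \<rho> a b = mmult (mmult (magic_mat a) \<rho>) (adj (magic_mat b))" for \<rho> a b
    \<comment> \<open>The index shuffle inverts \<open>magic_pauli\<close>.\<close>
    define chi where "chi k = (if k = 0 then G 1 1 else if k = 1 then G 3 3
        else if k = 2 then G 4 4 else G 2 2)" for k :: nat
    have G_nonneg: "0 \<le> G a a" for a
      unfolding G_def by (intro sum_nonneg mult_nonneg_nonneg[OF p]) auto
    have "E \<rho> m n = (\<Sum>k\<in>{0..3}. complex_of_real (chi k) * uchan (pauli k) \<rho> m n)" for \<rho> m n
    proof -
      have "E \<rho> m n = (\<Sum>j\<in>J. \<Sum>a\<in>{1..4}. \<Sum>b\<in>{1..4}. complex_of_real (p j * (r j a * r j b)) * T \<rho> a b m n)"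
        unfolding E
      proof (intro sum.cong refl)
        fix j assume j: "j \<in> J"
        have "uchan (W j) \<rho> m n = (\<Sum>a\<in>{1..4}. \<Sum>b\<in>{1..4}. complex_of_real (r j a * r j b) * T \<rho> a b m n)"
          unfolding uchan_mcoord[of "W j"] T_def by (intro sum.cong refl) (simp only: r[OF j])
        thus "complex_of_real (p j) * uchan (W j) \<rho> m n
            = (\<Sum>a\<in>{1..4}. \<Sum>b\<in>{1..4}. complex_of_real (p j * (r j a * r j b)) * T \<rho> a b m n)"
          by (simp add: sum_distrib_left mult.assoc)
      qed
      also have "\<dots> = (\<Sum>a\<in>{1..4}. \<Sum>b\<in>{1..4}. complex_of_real (G a b) * T \<rho> a b m n)"
        unfolding G_def of_real_sum sum_distrib_right
        by (subst sum.swap, intro sum.cong refl, rule sum.swap)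
      also have "\<dots> = (\<Sum>a\<in>{1..4}. complex_of_real (G a a) * T \<rho> a a m n)"
      proof (intro sum.cong refl)
        fix a :: nat assume a: "a \<in> {1..4}"
        have "(\<Sum>b\<in>{1..4}. complex_of_real (G a b) * T \<rho> a b m n)
            = (\<Sum>b\<in>{1..4}. if b = a then complex_of_real (G a a) * T \<rho> a a m n else 0)"
          using off' a by (intro sum.cong refl) auto
        also have "\<dots> = complex_of_real (G a a) * T \<rho> a a m n"
          using a by simp
        finally show "(\<Sum>b\<in>{1..4}. complex_of_real (G a b) * T \<rho> a b m n) = complex_of_real (G a a) * T \<rho> a a m n" .
      qed
      also have "\<dots> = (\<Sum>a\<in>{1..4}. complex_of_real (G a a) * uchan (pauli (magic_pauli a)) \<rho> m n)"
        by (intro sum.cong refl) (simp only: T_def uchan_magic_mat)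
      also have "\<dots> = (\<Sum>k\<in>{0..3}. complex_of_real (chi k) * uchan (pauli k) \<rho> m n)"
        unfolding sum_1_4 sum_0_3 by (simp add: magic_pauli_def chi_def)
      finally show ?thesis .
    qed
    moreover have "\<forall>k\<in>{0..3}. 0 \<le> chi k"
      by (simp add: chi_def G_nonneg)
    ultimately show "pauli_channel E"
      unfolding pauli_channel_iff_uchan by blast
  qed
qed

section \<open>Diamond distances and magic coordinates\<close>

lemma mixture_comp_uchan_adj:
  "(mixture p (\<lambda>j. uchan (Ut j)) \<circ> uchan (adj U)) \<rho> r s
    = (\<Sum>j\<in>{1..7}. complex_of_real (p j) * uchan (mmult (Ut j) (adj U)) \<rho> r s)"
  by (simp add: mixture_def uchan_mmult)

text \<open>With \<open>chi\<close> the Pauli weights of the remnant, both sides equal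
  \<open>2 * (1 - chi 0)\<close>. The upper bound writes the difference as a combination of the
  channels of \<open>mmult (pauli k) U\<close>; the lower bound tests it on one rotated maximally
  entangled state.\<close>

lemma diamond_norm_pauli_remnant:
  assumes U: "unitary_mat U" and Ut: "\<And>j. j \<in> {1..7} \<Longrightarrow> unitary_mat (Ut j)"
    and r: "\<And>j a b. j \<in> {1..7} \<Longrightarrow> a \<in> {1..4} \<Longrightarrow> b \<in> {1..4} \<Longrightarrow>
      mcoord a (mmult (Ut j) (adj U)) * cnj (mcoord b (mmult (Ut j) (adj U))) = complex_of_real (r j a * r j b)"
    and r1: "\<And>j. j \<in> {1..7} \<Longrightarrow> (\<Sum>a\<in>{1..4}. (r j a)\<^sup>2) = 1"
    and p: "prob_dist7 p"
    and pauli: "pauli_channel (mixture p (\<lambda>j. uchan (Ut j)) \<circ> uchan (adj U))"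
  shows "diamond_norm (qdiff (uchan U) (mixture p (\<lambda>j. uchan (Ut j))))
    = 2 * (\<Sum>j\<in>{1..7}. p j * (1 - (r j 1)\<^sup>2))"
proof (rule antisym)
  let ?\<Phi> = "qdiff (uchan U) (mixture p (\<lambda>j. uchan (Ut j)))"
  let ?E = "mixture p (\<lambda>j. uchan (Ut j)) \<circ> uchan (adj U)"
  define W where "W j = mmult (Ut j) (adj U)" for j
  have W: "unitary_mat (W j)" if "j \<in> {1..7}" for j
    using that U Ut by (simp add: W_def unitary_mat_mmult unitary_mat_adj)
  have p0: "\<And>j. j \<in> {1..7} \<Longrightarrow> 0 \<le> p j" and p1: "(\<Sum>j\<in>{1..7}. p j) = 1"
    using p by (auto simp: prob_dist7_def)
  have F: "2 * (\<Sum>j\<in>{1..7}. p j * (1 - (r j 1)\<^sup>2)) = 2 * (1 - (\<Sum>j\<in>{1..7}. p j * (r j 1)\<^sup>2))"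
    using p1 by (simp add: right_diff_distrib sum_subtractf)
  obtain chi :: "nat \<Rightarrow> real" where chi0: "\<And>k. k \<in> {0..3} \<Longrightarrow> 0 \<le> chi k" and
    chi: "\<And>\<rho> r s. ?E \<rho> r s = (\<Sum>k\<in>{0..3}. complex_of_real (chi k) * uchan (pauli k) \<rho> r s)"
    using pauli unfolding pauli_channel_iff_uchan by blast
  \<comment> \<open>Diagonal Choi entries, computed once from the mixture and once from the Pauli
    form, identify the weights.\<close>
  have chi_eq: "chi (magic_pauli a) = (\<Sum>j\<in>{1..7}. p j * (r j a)\<^sup>2)" if a: "a \<in> {1..4}" for a
  proof -
    have "complex_of_real (\<Sum>j\<in>{1..7}. p j * (r j a * r j a)) = in_MB (choi ?E) a a / 2"
      unfolding in_MB_choi_lincomb_uchan[OF mixture_comp_uchan_adj] using a by (simp add: r)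
    also have "\<dots> = (\<Sum>k\<in>{0..3}. complex_of_real (chi k) * (if k = magic_pauli a then 1 else 0))"
      unfolding in_MB_choi_lincomb_uchan[OF chi]
      by (intro sum.cong refl) (simp add: mcoord_pauli[OF a a])
    also have "\<dots> = (\<Sum>k\<in>{0..3}. if k = magic_pauli a then complex_of_real (chi k) else 0)"
      by (intro sum.cong refl) auto
    also have "\<dots> = complex_of_real (chi (magic_pauli a))"
      by (subst sum.delta) (auto simp: magic_pauli_def)
    finally show ?thesis
      by (simp only: of_real_eq_iff power2_eq_square)
  qed
  have "chi 0 + chi 1 + chi 2 + chi 3 = (\<Sum>a\<in>{1..4}. chi (magic_pauli a))"
    unfolding sum_1_4 by (simp add: magic_pauli_def)
  also have "\<dots> = (\<Sum>a\<in>{1..4}. \<Sum>j\<in>{1..7}. p j * (r j a)\<^sup>2)"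
    by (intro sum.cong refl chi_eq)
  also have "\<dots> = (\<Sum>j\<in>{1..7}. p j * (\<Sum>a\<in>{1..4}. (r j a)\<^sup>2))"
    by (subst sum.swap) (simp add: sum_distrib_left)
  also have "\<dots> = (\<Sum>j\<in>{1..7}. p j)"
    by (intro sum.cong refl) (simp only: r1 mult_1_right)
  also note p1
  finally have chi_sum: "chi 0 + chi 1 + chi 2 + chi 3 = 1" .
  have chi_0: "chi 0 = (\<Sum>j\<in>{1..7}. p j * (r j 1)\<^sup>2)"
    using chi_eq[of 1] by (simp add: magic_pauli_def)

  \<comment> \<open>The identity part keeps \<open>1 - chi 0\<close> and the other Paulis enter
    negatively. As the weights sum to 1, the absolute values add up to
    \<open>2 * (1 - chi 0)\<close>.\<close>
  define c where "c k = (if k = 0 then 1 - chi 0 else - chi k)" for k :: nat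
  have U_adj: "uchan (adj U) (uchan U \<rho>) = \<rho>" for \<rho>
    using U by (simp add: uchan_mmult unitary_mat_def uchan_idm)
  have "?\<Phi> \<rho> m n = (\<Sum>k\<in>{0..3}. complex_of_real (c k) * uchan (mmult (pauli k) U) \<rho> m n)" for \<rho> m n
  proof -
    have "mixture p (\<lambda>j. uchan (Ut j)) \<rho> m n = ?E (uchan U \<rho>) m n"
      by (simp add: U_adj)
    also have "\<dots> = (\<Sum>k\<in>{0..3}. complex_of_real (chi k) * uchan (mmult (pauli k) U) \<rho> m n)"
      unfolding chi by (simp add: uchan_mmult)
    finally have "?\<Phi> \<rho> m n = uchan U \<rho> m n - (\<Sum>k\<in>{0..3}. complex_of_real (chi k) * uchan (mmult (pauli k) U) \<rho> m n)"
      by (simp add: qdiff_def)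
    moreover have "pauli 0 = idm"
      by (simp add: pauli_def idm_def)
    ultimately show ?thesis
      unfolding sum_0_3 by (simp add: c_def algebra_simps)
  qed
  hence "diamond_norm ?\<Phi> \<le> (\<Sum>k\<in>{0..3}. \<bar>c k\<bar>)"
    by (rule diamond_norm_lincomb_uchan_le[rotated 2]) (auto intro!: unitary_mat_mmult unitary_mat_pauli U)
  also have "\<dots> = 2 * (1 - chi 0)"
    unfolding sum_0_3 using chi_sum chi0[of 0] chi0[of 1] chi0[of 2] chi0[of 3] by (simp add: c_def)
  finally show "diamond_norm ?\<Phi> \<le> 2 * (\<Sum>j\<in>{1..7}. p j * (1 - (r j 1)\<^sup>2))"
    unfolding F chi_0 .

  \<comment> \<open>\<open>U\<close> maps this state to the maximally entangled state
    \<open>\<xi>\<close>, while \<open>Ut j\<close> maps it to the Choi state of \<open>W j\<close>.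
    The reflection in \<open>\<xi>\<close> then serves as trace norm witness.\<close>
  define X where "X = pure_state (choi_vec (adj U))"
  define \<xi> where "\<xi> = choi_vec idm"
  have X: "trace_norm X \<le> 1"
    unfolding X_def by (intro trace_norm_pure_le cip_choi_vec_self unitary_mat_adj U)
  \<comment> \<open>The free index 0 is given to the target channel, so the mixture keeps its
    indices 1 to 7.\<close>
  define V where "V k = (if k = 0 then U else Ut k)" for k :: nat
  define d where "d k = (if k = 0 then 1 else - p k)" for k :: nat
  have split7: "(\<Sum>k\<in>{0..7::nat}. f k) = f 0 + (\<Sum>k\<in>{1..7}. f k)" for f :: "nat \<Rightarrow> complex"
    by (simp add: sum.atLeast_Suc_atMost)
  have \<Phi>_lin: "?\<Phi> \<rho> m n = (\<Sum>k\<in>{0..7}. complex_of_real (d k) * uchan (V k) \<rho> m n)" for \<rho> m n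
    unfolding split7 by (simp add: qdiff_def mixture_def d_def V_def sum_negf)
  have "trace_norm (id_tensor ?\<Phi> X) \<le> diamond_norm ?\<Phi>"
    using U Ut X by (intro diamond_norm_lincomb_uchan_ge[OF _ _ \<Phi>_lin]) (auto simp: V_def)
  moreover have "id_tensor ?\<Phi> X = (\<lambda>x y. pure_state \<xi> x y
      - (\<Sum>j\<in>{1..7}. complex_of_real (p j) * pure_state (choi_vec (W j)) x y))" (is "_ = ?A")
  proof -
    have "id_tensor ?\<Phi> X = (\<lambda>x y. id_tensor (uchan U) X x y
      - (\<Sum>j\<in>{1..7}. complex_of_real (p j) * id_tensor (uchan (Ut j)) X x y))"
      by (auto simp: id_tensor_def qdiff_def mixture_def fun_eq_iff)
    thus ?thesis
      using U by (simp add: X_def id_tensor_uchan_choi_vec \<xi>_def W_def unitary_mat_adj_right)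
  qed
  moreover have "2 * (1 - (\<Sum>j\<in>{1..7}. p j * (r j 1)\<^sup>2)) \<le> trace_norm ?A"
  proof -
    have \<xi>: "cip \<xi> \<xi> = 1"
      by (simp add: \<xi>_def cip_choi_vec_self unitary_mat_idm)
    have "mtrace ?A = mtrace (pure_state \<xi>) - (\<Sum>j\<in>{1..7}. complex_of_real (p j) * mtrace (pure_state (choi_vec (W j))))"
      unfolding mtrace_def sum_distrib_left sum_subtractf by (subst sum.swap) simp
    also have "(\<Sum>j\<in>{1..7}. complex_of_real (p j) * mtrace (pure_state (choi_vec (W j))))
        = (\<Sum>j\<in>{1..7}. complex_of_real (p j))"
      by (intro sum.cong refl) (simp add: mtrace_pure cip_choi_vec_self W)
    also have "mtrace (pure_state \<xi>) - (\<Sum>j\<in>{1..7}. complex_of_real (p j)) = 0"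
      using p1 \<xi> by (simp add: mtrace_pure flip: of_real_sum)
    finally have tr: "mtrace ?A = 0" .
    have ov: "(cmod (cip (choi_vec (W j)) \<xi>))\<^sup>2 = (r j 1)\<^sup>2" if "j \<in> {1..7}" for j
    proof -
      have "cip (choi_vec (W j)) \<xi> = cnj (mcoord 1 (W j))"
        unfolding \<xi>_def cip_choi_vec_mcoord sum_1_4 mcoord_simps[of idm] by (simp add: idm_def)
      hence "complex_of_real ((cmod (cip (choi_vec (W j)) \<xi>))\<^sup>2) = mcoord 1 (W j) * cnj (mcoord 1 (W j))"
        by (simp only: complex_mod_cnj complex_norm_square)
      also have "\<dots> = complex_of_real (r j 1 * r j 1)"
        unfolding W_def using that by (intro r) auto
      finally show ?thesis
        by (simp only: of_real_eq_iff power2_eq_square)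
    qed
    have "(\<Sum>y\<in>UNIV. ?A x y * \<xi> y) = (\<Sum>y\<in>UNIV. pure_state \<xi> x y * \<xi> y)
        - (\<Sum>j\<in>{1..7}. complex_of_real (p j) * (\<Sum>y\<in>UNIV. pure_state (choi_vec (W j)) x y * \<xi> y))" for x
      unfolding left_diff_distrib sum_subtractf sum_distrib_left sum_distrib_right mult.assoc
      by (subst sum.swap) (rule refl)
    hence "cip \<xi> (\<lambda>x. \<Sum>y\<in>UNIV. ?A x y * \<xi> y)
        = cip \<xi> (\<lambda>x. \<Sum>y\<in>UNIV. pure_state \<xi> x y * \<xi> y)
        - cip \<xi> (\<lambda>x. \<Sum>j\<in>{1..7}. complex_of_real (p j) * (\<Sum>y\<in>UNIV. pure_state (choi_vec (W j)) x y * \<xi> y))"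
      by (simp only: cip_diff_right)
    also have "cip \<xi> (\<lambda>x. \<Sum>j\<in>{1..7}. complex_of_real (p j) * (\<Sum>y\<in>UNIV. pure_state (choi_vec (W j)) x y * \<xi> y))
        = (\<Sum>j\<in>{1..7}. complex_of_real (p j) * cip \<xi> (\<lambda>x. \<Sum>y\<in>UNIV. pure_state (choi_vec (W j)) x y * \<xi> y))"
    proof -
      have "cip \<xi> (\<lambda>x. \<Sum>j\<in>J. c j * f j x) = (\<Sum>j\<in>J. c j * cip \<xi> (f j))" for J :: "nat set" and c f
        unfolding cip_def sum_distrib_left by (subst sum.swap) (simp add: mult_ac)
      thus ?thesis .
    qed
    finally have "cip \<xi> (\<lambda>x. \<Sum>y\<in>UNIV. ?A x y * \<xi> y)
        = complex_of_real ((cmod (cip \<xi> \<xi>))\<^sup>2) - (\<Sum>j\<in>{1..7}. complex_of_real (p j) * complex_of_real ((r j 1)\<^sup>2))"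
      by (simp only: cip_pure_state ov cong: sum.cong)
    hence "Re (cip \<xi> (\<lambda>x. \<Sum>y\<in>UNIV. ?A x y * \<xi> y)) = 1 - (\<Sum>j\<in>{1..7}. p j * (r j 1)\<^sup>2)"
      using \<xi> by (simp flip: of_real_mult of_real_sum of_real_power)
    thus ?thesis
      using trace_norm_ge_reflection[OF \<xi>, of ?A] tr by simp
  qed
  ultimately show "2 * (\<Sum>j\<in>{1..7}. p j * (1 - (r j 1)\<^sup>2)) \<le> diamond_norm ?\<Phi>"
    unfolding F by simp
qed

text \<open>The diamond distance dominates the trace distance of the two Choi states, which is
  \<open>2 * sqrt (1 - T\<^sup>2)\<close> for the overlap \<open>T\<close> of \<open>e\<close> and
  \<open>r\<close>. Closeness of the channels thus forces \<open>T\<^sup>2\<close> to be near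
  1.\<close>

lemma close_unitary_coords:
  assumes U: "unitary_mat U" "unitary_mat A" "unitary_mat B"
    and e: "\<And>a b. a \<in> {1..4} \<Longrightarrow> b \<in> {1..4} \<Longrightarrow>
      in_MB (choi (uchan A \<circ> uchan (adj U))) a b / 2 = complex_of_real (e a * e b)"
    and d: "diamond_norm (qdiff (uchan A) (uchan B)) / 2 \<le> \<epsilon>"
  obtains r where "\<And>a b. a \<in> {1..4} \<Longrightarrow> b \<in> {1..4} \<Longrightarrow>
      mcoord a (mmult B (adj U)) * cnj (mcoord b (mmult B (adj U))) = complex_of_real (r a * r b)"
    "(\<Sum>a\<in>{1..4}. (r a)\<^sup>2) = 1" "0 \<le> (\<Sum>a\<in>{1..4}. e a * r a)"
    "1 - \<epsilon>\<^sup>2 \<le> (\<Sum>a\<in>{1..4}. e a * r a)\<^sup>2"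
proof -
  define H where "H = mmult A (adj U)"
  define W where "W = mmult B (adj U)"
  have HW: "unitary_mat H" "unitary_mat W"
    using U by (simp_all add: H_def W_def unitary_mat_mmult unitary_mat_adj)
  have "uchan A \<circ> uchan (adj U) = uchan H"
    by (simp add: fun_eq_iff uchan_mmult H_def)
  hence h: "mcoord a H * cnj (mcoord b H) = complex_of_real (e a * e b)"
    if "a \<in> {1..4}" "b \<in> {1..4}" for a b
    using e[OF that] by (simp only: in_MB_choi_uchan)
  obtain u r0 where u: "cmod u = 1" and r0: "\<And>a. a \<in> {1..4} \<Longrightarrow> mcoord a W = u * complex_of_real (r0 a)"
    and r0_1: "(\<Sum>a\<in>{1..4}. (r0 a)\<^sup>2) = 1"
    using unitary_mcoord_real[OF HW(2)] by blast
  \<comment> \<open>The channel fixes \<open>r\<close> only up to sign; the sign is chosen to make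
    the overlap with \<open>e\<close> nonnegative.\<close>
  define \<sigma> :: real where "\<sigma> = (if 0 \<le> (\<Sum>a\<in>{1..4}. e a * r0 a) then 1 else - 1)"
  have \<sigma>: "\<sigma> * \<sigma> = 1" by (simp add: \<sigma>_def)
  define r where "r a = \<sigma> * r0 a" for a
  define T where "T = (\<Sum>a\<in>{1..4}. e a * r a)"
  have "T = \<sigma> * (\<Sum>a\<in>{1..4}. e a * r0 a)"
    unfolding T_def r_def sum_distrib_left by (intro sum.cong refl) simp
  hence T0: "0 \<le> T"
    by (simp add: \<sigma>_def)
  have uu: "u * cnj u = 1"
    using complex_norm_square[of u] u by simp
  have w: "mcoord a W * cnj (mcoord b W) = complex_of_real (r a * r b)"
    if "a \<in> {1..4}" "b \<in> {1..4}" for a b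
  proof -
    have "mcoord a W * cnj (mcoord b W) = (u * cnj u) * complex_of_real ((\<sigma> * \<sigma>) * (r0 a * r0 b))"
      unfolding \<sigma> by (simp add: r0[OF that(1)] r0[OF that(2)] mult_ac)
    also have "\<dots> = complex_of_real (r a * r b)"
      unfolding uu by (simp add: r_def mult_ac)
    finally show ?thesis .
  qed
  have r_1: "(\<Sum>a\<in>{1..4}. (r a)\<^sup>2) = 1"
  proof -
    have "(r a)\<^sup>2 = (r0 a)\<^sup>2" for a
      by (simp add: r_def \<sigma>_def)
    thus ?thesis using r0_1 by simp
  qed
  have ov: "(cmod (cip (choi_vec H) (choi_vec W)))\<^sup>2 = T\<^sup>2"
  proof -
    have "complex_of_real ((cmod (cip (choi_vec H) (choi_vec W)))\<^sup>2)
        = cip (choi_vec H) (choi_vec W) * cnj (cip (choi_vec H) (choi_vec W))"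
      by (rule complex_norm_square)
    also have "\<dots> = (\<Sum>a\<in>{1..4}. \<Sum>b\<in>{1..4}.
        (mcoord b H * cnj (mcoord a H)) * (mcoord a W * cnj (mcoord b W)))"
      unfolding cip_choi_vec_mcoord cnj_sum sum_product by (simp add: mult_ac)
    also have "\<dots> = (\<Sum>a\<in>{1..4}. \<Sum>b\<in>{1..4}. complex_of_real ((e a * r a) * (e b * r b)))"
      by (intro sum.cong refl) (simp only: h w, simp add: mult_ac)
    also have "\<dots> = complex_of_real (T\<^sup>2)"
      by (simp add: T_def power2_eq_square sum_product)
    finally show ?thesis
      by (simp only: of_real_eq_iff)
  qed
  have "1 - T\<^sup>2 \<le> \<epsilon>\<^sup>2"
  proof (cases "1 - T\<^sup>2 \<le> 0")
    case True
    thus ?thesis by (smt (verit) zero_le_power2)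
  next
    case False
    define s where "s = sqrt (1 - T\<^sup>2)"
    define X where "X = pure_state (choi_vec (adj U))"
    let ?\<Phi> = "qdiff (uchan A) (uchan B)"
    have s: "0 < s" "s\<^sup>2 = 1 - T\<^sup>2"
      using False by (simp_all add: s_def)
    have X: "trace_norm X \<le> 1"
      unfolding X_def by (intro trace_norm_pure_le cip_choi_vec_self unitary_mat_adj U)
    have "id_tensor ?\<Phi> X = (\<lambda>x y. id_tensor (uchan A) X x y - id_tensor (uchan B) X x y)"
      by (auto simp: id_tensor_def qdiff_def fun_eq_iff)
    also have "\<dots> = (\<lambda>x y. pure_state (choi_vec H) x y - pure_state (choi_vec W) x y)"
      by (simp add: X_def id_tensor_uchan_choi_vec H_def W_def)
    finally have "2 * s \<le> trace_norm (id_tensor ?\<Phi> X)"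
      using trace_norm_pure_diff_ge[of "choi_vec H" "choi_vec W" s] s ov HW
      by (simp add: cip_choi_vec_self)
    also have "\<dots> \<le> diamond_norm ?\<Phi>"
    \<comment> \<open>The booleans label the two channels, with coefficient 1 for \<open>A\<close>
      and -1 for \<open>B\<close>.\<close>
    proof (rule diamond_norm_lincomb_uchan_ge[where K = UNIV and V = "\<lambda>k. if k then B else A"
          and c = "\<lambda>k. if k then - 1 else 1"])
      show "?\<Phi> \<rho> m n = (\<Sum>k\<in>UNIV. complex_of_real (if k then - 1 else 1) * uchan (if k then B else A) \<rho> m n)" for \<rho> m n
        by (simp add: qdiff_def sum_UNIV_bool)
    qed (use U X in auto)
    finally have "s \<le> \<epsilon>"
      using d by simp
    hence "s\<^sup>2 \<le> \<epsilon>\<^sup>2"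
      using s(1) by (intro power_mono) auto
    thus ?thesis
      using s(2) by simp
  qed
  hence "1 - \<epsilon>\<^sup>2 \<le> T\<^sup>2" by simp
  with w r_1 T0 show ?thesis
    unfolding T_def W_def by (intro that) auto
qed

section \<open>From the seven design points to admissible weights\<close>

text \<open>A product of two coordinates moves by at most \<open>3 * \<eta>\<close>, because the
  factors satisfy \<open>\<bar>y a\<bar> \<le> 2\<close> and \<open>\<bar>d b\<bar> \<le> 1\<close>;
  there are six such products.\<close>

lemma norm_off_diag_diff_le:
  assumes close: "\<And>k. k \<in> {1..4} \<Longrightarrow> \<bar>y k - d k\<bar> \<le> \<eta>" and d: "\<And>k. k \<in> {1..4} \<Longrightarrow> \<bar>d k\<bar> \<le> 1"
    and \<eta>: "\<eta> \<le> 1"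
  shows "norm (off_diag y - off_diag d) \<le> 18 * \<eta>"
proof -
  have prod: "\<bar>y a * y b - d a * d b\<bar> \<le> 3 * \<eta>" if "a \<in> {1..4}" "b \<in> {1..4}" for a b
  proof -
    have "0 \<le> \<eta>"
      using close[OF that(1)] by linarith
    have "\<bar>y a\<bar> \<le> 2"
      using close[OF that(1)] d[OF that(1)] \<eta> by linarith
    have "y a * y b - d a * d b = y a * (y b - d b) + d b * (y a - d a)"
      by (simp add: algebra_simps)
    hence "\<bar>y a * y b - d a * d b\<bar> \<le> \<bar>y a\<bar> * \<bar>y b - d b\<bar> + \<bar>d b\<bar> * \<bar>y a - d a\<bar>"
      by (metis abs_mult abs_triangle_ineq)
    also have "\<dots> \<le> 2 * \<eta> + 1 * \<eta>"
      using close[OF that(1)] close[OF that(2)] d[OF that(2)] \<open>\<bar>y a\<bar> \<le> 2\<close> \<open>0 \<le> \<eta>\<close>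
      by (intro add_mono mult_mono) auto
    finally show ?thesis by simp
  qed
  have tuple: "norm ((a1, a2, a3, b1, b2, b3) :: r6) \<le> \<bar>a1\<bar> + (\<bar>a2\<bar> + (\<bar>a3\<bar> + (\<bar>b1\<bar> + (\<bar>b2\<bar> + \<bar>b3\<bar>))))"
    for a1 a2 a3 b1 b2 b3
    by (intro order.trans[OF norm_Pair_le] add_mono) simp_all
  have "norm (off_diag y - off_diag d) \<le> 3 * \<eta> + (3 * \<eta> + (3 * \<eta> + (3 * \<eta> + (3 * \<eta> + 3 * \<eta>))))"
    unfolding off_diag_def minus_prod_def fst_conv snd_conv
    by (rule order.trans[OF tuple]) (intro add_mono prod; simp)
  thus ?thesis by simp
qed

lemma abs_design_vec_le: "\<bar>design_vec j k\<bar> \<le> 1"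
  using component_le_norm_cart[of "design j"] by (simp add: design_vec_def norm_design)

definition pauli_weights :: "bool cmat \<Rightarrow> (nat \<Rightarrow> bool cmat) \<Rightarrow> (nat \<Rightarrow> real) \<Rightarrow> bool" where
  "pauli_weights U Ut p \<longleftrightarrow> prob_dist7 p \<and> pauli_channel (mixture p (\<lambda>j. uchan (Ut j)) \<circ> uchan (adj U))"

definition mixing_error :: "bool cmat \<Rightarrow> (nat \<Rightarrow> bool cmat) \<Rightarrow> (nat \<Rightarrow> real) \<Rightarrow> real" where
  "mixing_error U Ut p = diamond_norm (qdiff (uchan U) (mixture p (\<lambda>j. uchan (Ut j))))"

text \<open>Rescaled coordinates lie within \<open>3 / c\<close> of the design, so their
  off-diagonal vectors move by at most \<open>18 * (3 / c) = 54 / c < \<delta>\<close> and stability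
  supplies weights. The two-sided estimate holds for all admissible weights, hence for a minimiser,
  whose existence is the first claim.\<close>

lemma pauli_weights_of_close_unitaries:
  assumes stable: "\<forall>x'. (\<forall>j\<in>{1..7}. norm (x' j - off_diag (design_vec j)) < \<delta>)
      \<longrightarrow> 0 \<in> convex hull (x' ` {1..7::nat})"
    and c: "3 \<le> c" "54 / c < \<delta>"
    and \<epsilon>: "0 < \<epsilon>" "\<epsilon> \<le> 1 / c ^ 3"
    and U: "unitary_mat U" "\<And>j. j \<in> {1..7} \<Longrightarrow> unitary_mat (Uh j)" "\<And>j. j \<in> {1..7} \<Longrightarrow> unitary_mat (Ut j)"
    and e: "\<And>j a b. j \<in> {1..7} \<Longrightarrow> a \<in> {1..4} \<Longrightarrow> b \<in> {1..4} \<Longrightarrow>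
          in_MB (choi (uchan (Uh j) \<circ> uchan (adj U))) a b / 2
            = complex_of_real (ehat c \<epsilon> (design j) a * ehat c \<epsilon> (design j) b)"
    and d: "\<And>j. j \<in> {1..7} \<Longrightarrow> diamond_norm (qdiff (uchan (Uh j)) (uchan (Ut j))) / 2 \<le> \<epsilon>"
  shows "\<exists>p. pauli_weights U Ut p \<and> (\<forall>q. pauli_weights U Ut q \<longrightarrow> mixing_error U Ut p \<le> mixing_error U Ut q)"
    and "\<And>p. pauli_weights U Ut p \<Longrightarrow>
      ((c - 1) * \<epsilon>)\<^sup>2 \<le> mixing_error U Ut p / 2 \<and> mixing_error U Ut p / 2 \<le> ((c + 1) * \<epsilon>)\<^sup>2"
proof -
  define W where "W j = mmult (Ut j) (adj U)" for j
  have "\<forall>j\<in>{1..7}. \<exists>r. (\<forall>a\<in>{1..4}. \<forall>b\<in>{1..4}. mcoord a (W j) * cnj (mcoord b (W j)) = complex_of_real (r a * r b))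
      \<and> (\<Sum>a\<in>{1..4}. (r a)\<^sup>2) = 1 \<and> 0 \<le> (\<Sum>a\<in>{1..4}. ehat c \<epsilon> (design j) a * r a)
      \<and> 1 - \<epsilon>\<^sup>2 \<le> (\<Sum>a\<in>{1..4}. ehat c \<epsilon> (design j) a * r a)\<^sup>2"
  proof
    fix j :: nat assume j: "j \<in> {1..7}"
    show "\<exists>r. (\<forall>a\<in>{1..4}. \<forall>b\<in>{1..4}. mcoord a (W j) * cnj (mcoord b (W j)) = complex_of_real (r a * r b))
      \<and> (\<Sum>a\<in>{1..4}. (r a)\<^sup>2) = 1 \<and> 0 \<le> (\<Sum>a\<in>{1..4}. ehat c \<epsilon> (design j) a * r a)
      \<and> 1 - \<epsilon>\<^sup>2 \<le> (\<Sum>a\<in>{1..4}. ehat c \<epsilon> (design j) a * r a)\<^sup>2"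
      unfolding W_def
      by (rule close_unitary_coords[OF U(1) U(2)[OF j] U(3)[OF j] e[OF j] d[OF j]]) blast+
  qed
  from bchoice[OF this] obtain r where
    r: "\<And>j a b. j \<in> {1..7} \<Longrightarrow> a \<in> {1..4} \<Longrightarrow> b \<in> {1..4} \<Longrightarrow>
        mcoord a (W j) * cnj (mcoord b (W j)) = complex_of_real (r j a * r j b)"
    and r1: "\<And>j. j \<in> {1..7} \<Longrightarrow> (\<Sum>a\<in>{1..4}. (r j a)\<^sup>2) = 1"
    and r2: "\<And>j. j \<in> {1..7} \<Longrightarrow> 0 \<le> (\<Sum>a\<in>{1..4}. ehat c \<epsilon> (design j) a * r j a)"
    and r3: "\<And>j. j \<in> {1..7} \<Longrightarrow> 1 - \<epsilon>\<^sup>2 \<le> (\<Sum>a\<in>{1..4}. ehat c \<epsilon> (design j) a * r j a)\<^sup>2"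
    by blast
  have c1: "1 \<le> c" using c(1) by simp
  have c3: "c * (1 / c ^ 3) = 1 / c\<^sup>2" "1 / c\<^sup>2 \<le> 1 / c" "1 / c \<le> 1 / 3" "1 / c ^ 3 \<le> 1 / c"
    using c(1) self_le_power[OF c1, of 2] self_le_power[OF c1, of 3]
    by (simp_all add: power2_eq_square power3_eq_cube divide_left_mono)
  have x: "c * \<epsilon> \<le> 1 / c"
    using mult_left_mono[OF \<epsilon>(2), of c] c(1) c3 by simp
  have x1: "0 < c * \<epsilon>" "c * \<epsilon> \<le> 1" "1 \<le> c"
    using x c3(3) c(1) \<epsilon>(1) by (simp, linarith, simp)
  note pert = ehat_perturbation[OF norm_design x1(3) \<epsilon>(1) x1(2) r1 r2 r3]

  \<comment> \<open>Undoing the factor \<open>c * \<epsilon>\<close> in the vector part makes the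
    coordinates comparable with \<open>design_vec\<close>.\<close>
  define y where "y j k = (if k = 1 then r j 1 else r j k / (c * \<epsilon>))" for j k :: nat
  have y_close: "\<bar>y j k - design_vec j k\<bar> \<le> 3 / c" if j: "j \<in> {1..7}" and k: "k \<in> {1..4}" for j k
  proof (cases "k = 1")
    case True
    \<comment> \<open>The first coordinate of \<open>ehat\<close> misses 1 by at most
      \<open>(c * \<epsilon>)\<^sup>2 \<le> 1 / c\<close>, and \<open>r j 1\<close> misses it by
      another \<open>2 * \<epsilon> \<le> 2 / c\<close>.\<close>
    have "(c * \<epsilon>)\<^sup>2 \<le> 1 / c * 1"
      unfolding power2_eq_square using x x1 by (intro mult_mono) auto
    moreover have "1 - (c * \<epsilon>)\<^sup>2 \<le> sqrt (1 - (c * \<epsilon>)\<^sup>2)"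
    proof (rule real_le_rsqrt)
      have "0 \<le> 1 - (c * \<epsilon>)\<^sup>2" "1 - (c * \<epsilon>)\<^sup>2 \<le> 1"
        using x1 by (simp_all add: power_le_one)
      from mult_left_mono[OF this(2,1)] show "(1 - (c * \<epsilon>)\<^sup>2)\<^sup>2 \<le> 1 - (c * \<epsilon>)\<^sup>2"
        by (simp add: power2_eq_square)
    qed
    moreover have "sqrt (1 - (c * \<epsilon>)\<^sup>2) \<le> 1" by simp
    moreover have "\<bar>sqrt (1 - (c * \<epsilon>)\<^sup>2) - r j 1\<bar> \<le> 2 * \<epsilon>"
      using pert(3)[OF j j j, of 1] by (simp add: ehat_def)
    moreover have "\<epsilon> \<le> 1 / c"
      using \<epsilon>(2) c3(4) by simp
    ultimately have "\<bar>r j 1 - 1\<bar> \<le> 3 * (1 / c)"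
      unfolding abs_le_iff by linarith
    thus ?thesis
      by (simp add: y_def design_vec_def True)
  next
    case False
    have "ehat c \<epsilon> (design j) k = c * \<epsilon> * design_vec j k"
      using False k by (auto simp: ehat_def design_vec_def)
    hence "\<bar>c * \<epsilon> * design_vec j k - r j k\<bar> \<le> 2 * \<epsilon>"
      using pert(3)[OF j j j k] by simp
    moreover have "y j k - design_vec j k = - (c * \<epsilon> * design_vec j k - r j k) / (c * \<epsilon>)"
      using False \<epsilon>(1) c1 by (simp add: y_def diff_divide_distrib)
    ultimately have "\<bar>y j k - design_vec j k\<bar> \<le> 2 * \<epsilon> / (c * \<epsilon>)"
      using x1(1) by (simp only: abs_divide abs_minus_cancel abs_of_pos) (rule divide_right_mono, auto)
    also have "\<dots> = 2 / c"
      using \<epsilon>(1) by simp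
    also have "\<dots> \<le> 3 / c"
      using c(1) by (intro divide_right_mono) auto
    finally show ?thesis .
  qed
  have "0 \<in> convex hull ((\<lambda>j. off_diag (y j)) ` {1..7})"
  proof (intro stable[rule_format] ballI)
    fix j :: nat assume j: "j \<in> {1..7}"
    have "norm (off_diag (y j) - off_diag (design_vec j)) \<le> 18 * (3 / c)"
      using y_close[OF j] abs_design_vec_le c(1) by (intro norm_off_diag_diff_le) auto
    thus "norm (off_diag (y j) - off_diag (design_vec j)) < \<delta>"
      using c(2) by simp
  qed
  then obtain p0 where p0: "\<forall>j\<in>{1..7}. 0 \<le> p0 j" "sum p0 {1..7} = 1" "(\<Sum>j\<in>{1..7}. p0 j *\<^sub>R off_diag (y j)) = 0"
    by (subst (asm) convex_hull_image_finite) auto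
  have p0_r: "(\<Sum>j\<in>{1..7}. p0 j *\<^sub>R off_diag (r j)) = 0"
  proof -
    \<comment> \<open>Passing from \<open>y\<close> back to \<open>r\<close> multiplies each
      off-diagonal sum by a factor independent of \<open>j\<close>, so vanishing is
      preserved.\<close>
    define \<kappa> where "\<kappa> a = (if a = 1 then 1 else c * \<epsilon>)" for a :: nat
    have "r j a = \<kappa> a * y j a" for j a
      using \<epsilon>(1) c1 by (simp add: \<kappa>_def y_def)
    hence "(\<Sum>j\<in>{1..7}. p0 j * (r j a * r j b)) = \<kappa> a * \<kappa> b * (\<Sum>j\<in>{1..7}. p0 j * (y j a * y j b))" for a b
      by (simp add: sum_distrib_left mult_ac)
    thus ?thesis
      using p0(3) unfolding sum_off_diag_eq_0_iff by simp
  qed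
  have weights_iff: "pauli_weights U Ut p \<longleftrightarrow>
      (\<forall>j\<in>{1..7}. 0 \<le> p j) \<and> sum p {1..7} = 1 \<and> (\<Sum>j\<in>{1..7}. p j *\<^sub>R off_diag (r j)) = 0" for p
    unfolding pauli_weights_def prob_dist7_def
    using pauli_channel_lincomb_iff[OF mixture_comp_uchan_adj, of Ut U r p] r unfolding W_def by blast
  have error: "mixing_error U Ut p = 2 * (\<Sum>j\<in>{1..7}. p j * (1 - (r j 1)\<^sup>2))" if "pauli_weights U Ut p" for p
    unfolding mixing_error_def
    using that U(1,3) r r1 unfolding W_def pauli_weights_def by (intro diamond_norm_pauli_remnant) auto
  obtain p where p: "pauli_weights U Ut p" and min: "\<And>q. pauli_weights U Ut q \<Longrightarrow>
      (\<Sum>j\<in>{1..7}. p j * (1 - (r j 1)\<^sup>2)) \<le> (\<Sum>j\<in>{1..7}. q j * (1 - (r j 1)\<^sup>2))"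
    unfolding weights_iff
    using exists_min_convex_weights[of "{1..7}" p0 "\<lambda>j. off_diag (r j)" "\<lambda>j. 1 - (r j 1)\<^sup>2"] p0 p0_r
    by blast
  show "\<exists>p. pauli_weights U Ut p \<and> (\<forall>q. pauli_weights U Ut q \<longrightarrow> mixing_error U Ut p \<le> mixing_error U Ut q)"
    using p min by (intro exI[of _ p]) (simp add: error)
  fix p assume p: "pauli_weights U Ut p"
  hence p': "\<And>j. j \<in> {1..7} \<Longrightarrow> 0 \<le> p j" "sum p {1..7} = 1"
    unfolding weights_iff by auto
  \<comment> \<open>Writing a constant as its own weighted average reduces both bounds to the
    individual unitaries.\<close>
  have average: "t = (\<Sum>j\<in>{1..7}. p j * t)" for t
    using p'(2) by (simp flip: sum_distrib_right)
  have "((c - 1) * \<epsilon>)\<^sup>2 \<le> (\<Sum>j\<in>{1..7}. p j * (1 - (r j 1)\<^sup>2))"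
    by (subst average) (intro sum_mono mult_left_mono p' pert(1))
  moreover have "(\<Sum>j\<in>{1..7}. p j * (1 - (r j 1)\<^sup>2)) \<le> ((c + 1) * \<epsilon>)\<^sup>2"
    by (subst (2) average) (intro sum_mono mult_left_mono p' pert(2))
  ultimately show "((c - 1) * \<epsilon>)\<^sup>2 \<le> mixing_error U Ut p / 2 \<and> mixing_error U Ut p / 2 \<le> ((c + 1) * \<epsilon>)\<^sup>2"
    by (simp add: error[OF p])
qed

theorem theoremS1:
  shows "\<exists>(c::real) (\<epsilon>0::real) (v::nat \<Rightarrow> real^3).
    c > 0 \<and> \<epsilon>0 > 0 \<and> (\<forall>j\<in>{1..7}. norm (v j) = 1) \<and>
    (\<forall>(U::bool cmat) (\<epsilon>::real) (Uh::nat \<Rightarrow> bool cmat) (Ut::nat \<Rightarrow> bool cmat).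
       unitary_mat U \<and> 0 < \<epsilon> \<and> \<epsilon> \<le> \<epsilon>0 \<and>
       (\<forall>j\<in>{1..7}. unitary_mat (Uh j)) \<and>
       (\<forall>j\<in>{1..7}. \<forall>a\<in>{1..4}. \<forall>b\<in>{1..4}.
          in_MB (choi (uchan (Uh j) \<circ> uchan (adj U))) a b / 2
            = complex_of_real (ehat c \<epsilon> (v j) a * ehat c \<epsilon> (v j) b)) \<and>
       (\<forall>j\<in>{1..7}. unitary_mat (Ut j)) \<and>
       (\<forall>j\<in>{1..7}. diamond_norm (qdiff (uchan (Uh j)) (uchan (Ut j))) / 2 \<le> \<epsilon>)
     \<longrightarrow>
       (\<exists>p. prob_dist7 p \<and>
            pauli_channel (mixture p (\<lambda>j. uchan (Ut j)) \<circ> uchan (adj U))) \<and>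
       (\<exists>p. prob_dist7 p \<and>
            pauli_channel (mixture p (\<lambda>j. uchan (Ut j)) \<circ> uchan (adj U)) \<and>
            (\<forall>q. prob_dist7 q \<and>
                 pauli_channel (mixture q (\<lambda>j. uchan (Ut j)) \<circ> uchan (adj U)) \<longrightarrow>
                 diamond_norm (qdiff (uchan U) (mixture p (\<lambda>j. uchan (Ut j))))
                   \<le> diamond_norm (qdiff (uchan U) (mixture q (\<lambda>j. uchan (Ut j)))))) \<and>
       (\<forall>p. prob_dist7 p \<and>
            pauli_channel (mixture p (\<lambda>j. uchan (Ut j)) \<circ> uchan (adj U)) \<and>
            (\<forall>q. prob_dist7 q \<and>
                 pauli_channel (mixture q (\<lambda>j. uchan (Ut j)) \<circ> uchan (adj U)) \<longrightarrow>
                 diamond_norm (qdiff (uchan U) (mixture p (\<lambda>j. uchan (Ut j))))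
                   \<le> diamond_norm (qdiff (uchan U) (mixture q (\<lambda>j. uchan (Ut j)))))
          \<longrightarrow> ((c - 1) * \<epsilon>)\<^sup>2 \<le> diamond_norm (qdiff (uchan U) (mixture p (\<lambda>j. uchan (Ut j)))) / 2
            \<and> diamond_norm (qdiff (uchan U) (mixture p (\<lambda>j. uchan (Ut j)))) / 2 \<le> ((c + 1) * \<epsilon>)\<^sup>2))"
proof -
  obtain \<delta> where "0 < \<delta>" and stable:
    "\<forall>x'. (\<forall>j\<in>{1..7}. norm (x' j - off_diag (design_vec j)) < \<delta>) \<longrightarrow> 0 \<in> convex hull (x' ` {1..7::nat})"
    by (rule zero_in_hull_stable[OF _ _ sum_design design_span]) simp_all
  \<comment> \<open>The value 3 ensures \<open>3 / c \<le> 1\<close>, as the product estimate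
    requires. Any constant above 54 could replace 100 in securing
    \<open>54 / c < \<delta>\<close>.\<close>
  define c where "c = max 3 (100 / \<delta>)"
  have c: "3 \<le> c" "54 / c < \<delta>"
  proof -
    show "3 \<le> c" by (simp add: c_def)
    have "100 \<le> c * \<delta>"
      using \<open>0 < \<delta>\<close> by (simp add: c_def field_simps max_def)
    thus "54 / c < \<delta>"
      using \<open>3 \<le> c\<close> by (simp add: field_simps)
  qed
  note core = pauli_weights_of_close_unitaries[OF stable c, unfolded pauli_weights_def mixing_error_def]
  show ?thesis
  proof (rule exI[of _ c], rule exI[of _ "1 / c ^ 3"], rule exI[of _ design], intro conjI, goal_cases)
    case 4
    show ?case
    proof (intro allI impI, goal_cases)
      case (1 U \<epsilon> Uh Ut)
      then have prems: "0 < \<epsilon>" "\<epsilon> \<le> 1 / c ^ 3" "unitary_mat U"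
        "\<And>j. j \<in> {1..7} \<Longrightarrow> unitary_mat (Uh j)" "\<And>j. j \<in> {1..7} \<Longrightarrow> unitary_mat (Ut j)"
        "\<And>j a b. j \<in> {1..7} \<Longrightarrow> a \<in> {1..4} \<Longrightarrow> b \<in> {1..4} \<Longrightarrow>
          in_MB (choi (uchan (Uh j) \<circ> uchan (adj U))) a b / 2
            = complex_of_real (ehat c \<epsilon> (design j) a * ehat c \<epsilon> (design j) b)"
        "\<And>j. j \<in> {1..7} \<Longrightarrow> diamond_norm (qdiff (uchan (Uh j)) (uchan (Ut j))) / 2 \<le> \<epsilon>"
        by blast+
      note min = core(1)[OF prems] and bounds = core(2)[OF prems]
      show ?case
        using min bounds by blast
    qed
  qed (use c(1) norm_design in auto)
qed

end
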